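(* For every $(f,\mathfrak{A})\in \mathrm{Diff}(V)\times \mathrm{Sp}(2n_v , \mathbb{R})$, the map $\mathbb{A}_{f,\mathfrak{A}}$ induces by restriction a bijection: \begin{equation*} \mathbb{A}_{f,\mathfrak{A}}\colon \mathrm{Conf}_U(\mathcal{G},\mathcal{J})\to \mathrm{Conf}_U(f_{\ast}\mathcal{G},\mathcal{J}^f_{\mathfrak{A}})\, , \end{equation*} such that it further restricts to a bijection of the corresponding spaces of solutions: \begin{equation*} \mathbb{A}_{f,\mathfrak{A}}\colon \mathrm{Sol}_U(\mathcal{G},\mathcal{J})\to \mathrm{Sol}_U(f_{\ast}\mathcal{G},\mathcal{J}^f_{\mathfrak{A}})\, , \end{equation*} where $f_{\ast}\mathcal{G}$ is the push-forward of $\mathcal{G}$ by $f\colon V\to V$ and $\mathcal{J}^{f}_{\mathfrak{A}} = \mathfrak{A}\,(\mathcal{J}\circ f^{-1})\,\mathfrak{A}^{-1}$.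
   Context: Let $U\subset\mathbb{R}^4$ be a contractible, non-empty, oriented, relatively compact open subset, and let $V\subset \mathbb{R}^{n_s}$ be an oriented open subset. Let $\mathcal{G}$ be a Riemannian metric on $V$. Equip $\mathbb{R}^{2n_v}$ with its standard symplectic form $\omega=\sum_a f_a^\ast\wedge e_a^\ast$ (in the canonical basis $(e_1,\dots,e_{n_v},f_1,\dots,f_{n_v})$), and let $\mathrm{Sp}(2n_v,\mathbb{R})$ be the group of linear automorphisms preserving $\omega$; $\mathrm{Diff}(V)$ denotes the orientation-preserving diffeomorphisms of $V$. A taming map is a smooth map $\mathcal{J}\colon V\to \mathrm{Aut}(\mathbb{R}^{2n_v})$ such that at each point $\mathcal{J}$ is a complex structure with $\omega(\mathcal{J}\xi_1,\mathcal{J}\xi_2)=\omega(\xi_1,\xi_2)$ and $\omega(\xi,\mathcal{J}\xi)>0$ for $\xi\neq 0$; equivalently $\mathcal{J}=\begin{pmatrix} -\mathcal{I}^{-1}\mathcal{R} & \mathcal{I}^{-1}\\ -\mathcal{I}-\mathcal{R}\mathcal{I}^{-1}\mathcal{R} & \mathcal{R}\mathcal{I}^{-1}\end{pmatrix}$ for smooth symmetric-matrix-valued $\mathcal{R},\mathcal{I}$ on $V$ with $\mathcal{I}$ positive definite. The configuration space $\mathrm{Conf}_U(\mathcal{G},\mathcal{J})$ is the set of triples $(g,\phi,\mathcal{V})$ with $g$ a Lorentzian metric on $U$, $\phi\in C^\infty(U,V)$ and $\mathcal{V}\in\Omega^2(U,\mathbb{R}^{2n_v})$ satisfying $\ast_g\mathcal{V}=-(\mathcal{J}\circ\phi)(\mathcal{V})$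 (equivalently $\mathcal{V}=(F, \mathcal{R}(\phi)F-\mathcal{I}(\phi)\ast F)^t$ with $F\in\Omega^2(U,\mathbb{R}^{n_v})$). The solution space $\mathrm{Sol}_U(\mathcal{G},\mathcal{J})\subset \mathrm{Conf}_U(\mathcal{G},\mathcal{J})$ consists of the triples satisfying the equations of motion of local bosonic supergravity: the Einstein equations $\mathrm{G}^g_{ab}= \mathcal{G}_{ij}(\phi) \partial_a \phi^i \partial_b \phi^j - \frac{1}{2} g_{ab} \mathcal{G}_{ij}(\phi) \partial_c \phi^i \partial^c \phi^j + 2 \mathcal{I}_{\Lambda \Sigma}(\phi) F^{\Lambda}_{ac} F^{\Sigma c}_b - \frac{1}{2} g_{ab} \mathcal{I}_{\Lambda \Sigma}(\phi) F^{\Lambda}_{cd} F^{\Sigma cd}$ (with $\mathrm{G}^g$ the Einstein tensor), the scalar equations $\nabla_a^g (\mathcal{G}_{ik}(\phi) \partial^a \phi^i) = \frac{1}{2} \partial_k \mathcal{G}_{ij}(\phi) \partial_a \phi^i \partial^a \phi^j + \frac{1}{2} \partial_k \mathcal{R}_{\Lambda \Sigma}(\phi) F^{\Lambda}_{ab} \ast F^{\Sigma ab} + \frac{1}{2} \partial_k \mathcal{I}_{\Lambda \Sigma}(\phi) F^{\Lambda}_{ab} F^{\Sigma ab}$, and the Maxwell equations, which are equivalent to $\mathrm{d}\mathcal{V}=0$. For $(f,\mathfrak{A})\in \mathrm{Diff}(V)\times \mathrm{Sp}(2n_v,\mathbb{R})$, the map $\mathbb{A}_{f,\mathfrak{A}}$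 sends $(g,\phi,\mathcal{V})\mapsto (g,f\circ\phi,\mathfrak{A}\mathcal{V})$ on $\mathrm{Lor}(U)\times C^\infty(U,V)\times\Omega^2(U,\mathbb{R}^{2n_v})$. *)

theory Defs
  imports "HOL-Analysis.Analysis"
begin

fun pder :: "'a::euclidean_space list \<Rightarrow> ('a \<Rightarrow> 'b::real_normed_vector) \<Rightarrow> 'a \<Rightarrow> 'b" where
  "pder [] f = f"
| "pder (d # ds) f = (\<lambda>x. frechet_derivative (pder ds f) (at x) d)"

definition smooth_on :: "'a::euclidean_space set \<Rightarrow> ('a \<Rightarrow> 'b::real_normed_vector) \<Rightarrow> bool" where
  "smooth_on S f \<longleftrightarrow> (\<forall>ds. pder ds f differentiable_on S)"

definition pd :: "(real^'n \<Rightarrow> 'b::real_normed_vector) \<Rightarrow> 'n \<Rightarrow> real^'n \<Rightarrow> 'b" where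
  "pd f k x = frechet_derivative f (at x) (axis k 1)"

text \<open>R^{2n_v} is indexed by 'v + 'v: Inl a is the basis vector e_a, Inr a is f_a.
  omega = sum_a f_a^* wedge e_a^*.\<close>
definition omega :: "real^('v::finite + 'v) \<Rightarrow> real^('v + 'v) \<Rightarrow> real" where
  "omega \<xi> \<eta> = (\<Sum>a\<in>UNIV. \<xi> $ Inr a * \<eta> $ Inl a - \<xi> $ Inl a * \<eta> $ Inr a)"

definition Sp :: "(real^('v::finite + 'v)^('v + 'v)) set" where
  "Sp = {A. invertible A \<and> (\<forall>\<xi> \<eta>. omega (A *v \<xi>) (A *v \<eta>) = omega \<xi> \<eta>)}"

definition taming_map :: "(real^'s::finite) set \<Rightarrow> (real^'s \<Rightarrow> real^('v::finite + 'v)^('v + 'v)) \<Rightarrow> bool" where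
  "taming_map V J \<longleftrightarrow> smooth_on V J \<and>
     (\<forall>p\<in>V. J p ** J p = - mat 1 \<and>
        (\<forall>\<xi> \<eta>. omega (J p *v \<xi>) (J p *v \<eta>) = omega \<xi> \<eta>) \<and>
        (\<forall>\<xi>. \<xi> \<noteq> 0 \<longrightarrow> omega \<xi> (J p *v \<xi>) > 0))"

text \<open>The matrices I and R determined by a taming map via
  J = ((-I^-1 R, I^-1), (-I - R I^-1 R, R I^-1)).\<close>
definition I_of :: "real^('v::finite + 'v)^('v + 'v) \<Rightarrow> real^'v^'v" where
  "I_of M = matrix_inv (\<chi> i j. M $ Inl i $ Inr j)"

definition R_of :: "real^('v::finite + 'v)^('v + 'v) \<Rightarrow> real^'v^'v" where
  "R_of M = - (I_of M ** (\<chi> i j. M $ Inl i $ Inl j))"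

definition riemannian_metric :: "(real^'s::finite) set \<Rightarrow> (real^'s \<Rightarrow> real^'s^'s) \<Rightarrow> bool" where
  "riemannian_metric V G \<longleftrightarrow> smooth_on V G \<and>
     (\<forall>p\<in>V. transpose (G p) = G p \<and> (\<forall>u. u \<noteq> 0 \<longrightarrow> u \<bullet> (G p *v u) > 0))"

definition Diff :: "(real^'s::finite) set \<Rightarrow> (real^'s \<Rightarrow> real^'s) set" where
  "Diff V = {f. bij_betw f V V \<and> smooth_on V f \<and> smooth_on V (inv_into V f) \<and>
               (\<forall>x\<in>V. det (matrix (frechet_derivative f (at x))) > 0)}"

definition push :: "(real^'s::finite) set \<Rightarrow> (real^'s \<Rightarrow> real^'s) \<Rightarrow> (real^'s \<Rightarrow> real^'s^'s) \<Rightarrow> real^'s \<Rightarrow> real^'s^'s" where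
  "push V f G y = (let x = inv_into V f y; D = matrix (frechet_derivative f (at x))
                   in transpose (matrix_inv D) ** G x ** matrix_inv D)"

definition Jtwist :: "(real^'s::finite) set \<Rightarrow> (real^'s \<Rightarrow> real^'s) \<Rightarrow> real^('v::finite + 'v)^('v + 'v)
     \<Rightarrow> (real^'s \<Rightarrow> real^('v + 'v)^('v + 'v)) \<Rightarrow> real^'s \<Rightarrow> real^('v + 'v)^('v + 'v)" where
  "Jtwist V f A J y = A ** J (inv_into V f y) ** matrix_inv A"

definition lorentz_diag :: "real^4^4" where
  "lorentz_diag = (\<chi> i j. if i = j then (if i = 0 then -1 else 1) else 0)"

definition is_lorentzian :: "real^4^4 \<Rightarrow> bool" where
  "is_lorentzian M \<longleftrightarrow> transpose M = M \<and>
     (\<exists>P. invertible P \<and> transpose P ** M ** P = lorentz_diag)"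

text \<open>Fields on U are represented extensionally (value undefined outside U).\<close>
definition Lor :: "(real^4) set \<Rightarrow> (real^4 \<Rightarrow> real^4^4) set" where
  "Lor U = {g. g \<in> extensional U \<and> smooth_on U g \<and> (\<forall>x\<in>U. is_lorentzian (g x))}"

text \<open>Levi-Civita symbol, eps 0 1 2 3 = 1 (standard orientation of R^4).\<close>
definition eps :: "4 \<Rightarrow> 4 \<Rightarrow> 4 \<Rightarrow> 4 \<Rightarrow> real" where
  "eps a b c d = det (\<chi> i::4. (axis (if i = 0 then a else if i = 1 then b else if i = 2 then c else d) 1 :: real^4))"

definition hodge :: "real^4^4 \<Rightarrow> 'w::real_vector^4^4 \<Rightarrow> 'w^4^4" where
  "hodge M w = (\<chi> a b. (sqrt \<bar>det M\<bar> / 2) *\<^sub>R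
      (\<Sum>c\<in>UNIV. \<Sum>d\<in>UNIV. \<Sum>e\<in>UNIV. \<Sum>h\<in>UNIV.
         (eps a b c d * matrix_inv M $ c $ e * matrix_inv M $ d $ h) *\<^sub>R w $ e $ h))"

definition christ :: "(real^4 \<Rightarrow> real^4^4) \<Rightarrow> real^4 \<Rightarrow> 4 \<Rightarrow> 4 \<Rightarrow> 4 \<Rightarrow> real" where
  "christ g x a b c = (1/2) * (\<Sum>d\<in>UNIV. matrix_inv (g x) $ a $ d *
      (pd (\<lambda>y. g y $ d $ c) b x + pd (\<lambda>y. g y $ d $ b) c x - pd (\<lambda>y. g y $ b $ c) d x))"

definition ricci :: "(real^4 \<Rightarrow> real^4^4) \<Rightarrow> real^4 \<Rightarrow> 4 \<Rightarrow> 4 \<Rightarrow> real" where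
  "ricci g x b d = (\<Sum>a\<in>UNIV. pd (\<lambda>y. christ g y a b d) a x - pd (\<lambda>y. christ g y a a b) d x
      + (\<Sum>e\<in>UNIV. christ g x a a e * christ g x e b d - christ g x a d e * christ g x e a b))"

definition scal :: "(real^4 \<Rightarrow> real^4^4) \<Rightarrow> real^4 \<Rightarrow> real" where
  "scal g x = (\<Sum>b\<in>UNIV. \<Sum>d\<in>UNIV. matrix_inv (g x) $ b $ d * ricci g x b d)"

definition einstein :: "(real^4 \<Rightarrow> real^4^4) \<Rightarrow> real^4 \<Rightarrow> 4 \<Rightarrow> 4 \<Rightarrow> real" where
  "einstein g x a b = ricci g x a b - (1/2) * g x $ a $ b * scal g x"

type_synonym ('s, 'v) field =
  "(real^4 \<Rightarrow> real^4^4) \<times> (real^4 \<Rightarrow> real^'s) \<times> (real^4 \<Rightarrow> real^('v + 'v)^4^4)"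

definition Conf :: "(real^4) set \<Rightarrow> (real^'s::finite) set \<Rightarrow> (real^'s \<Rightarrow> real^'s^'s)
    \<Rightarrow> (real^'s \<Rightarrow> real^('v::finite + 'v)^('v + 'v)) \<Rightarrow> ('s, 'v) field set" where
  "Conf U V G J = {(g, \<phi>, \<V>).
     g \<in> Lor U \<and>
     \<phi> \<in> extensional U \<and> smooth_on U \<phi> \<and> \<phi> ` U \<subseteq> V \<and>
     \<V> \<in> extensional U \<and> smooth_on U \<V> \<and> (\<forall>x\<in>U. \<forall>a b. \<V> x $ a $ b = - \<V> x $ b $ a) \<and>
     (\<forall>x\<in>U. hodge (g x) (\<V> x) = (\<chi> a b. - (J (\<phi> x) *v (\<V> x $ a $ b))))}"

text \<open>F^Lambda_ab = electric components of the 2-form.\<close>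
definition Ffld :: "(real^4 \<Rightarrow> real^('v::finite + 'v)^4^4) \<Rightarrow> real^4 \<Rightarrow> 'v \<Rightarrow> real^4^4" where
  "Ffld \<V> x L = (\<chi> a b. \<V> x $ a $ b $ Inl L)"

definition einstein_eq :: "(real^'s::finite \<Rightarrow> real^'s^'s) \<Rightarrow> (real^'s \<Rightarrow> real^('v::finite + 'v)^('v + 'v))
    \<Rightarrow> ('s, 'v) field \<Rightarrow> real^4 \<Rightarrow> bool" where
  "einstein_eq G J c x = (case c of (g, \<phi>, \<V>) \<Rightarrow>
     let gi = matrix_inv (g x); Gp = G (\<phi> x); Ip = I_of (J (\<phi> x));
         d\<phi> = (\<lambda>a i. pd \<phi> a x $ i); F = Ffld \<V> x in
     (\<forall>a b. einstein g x a b =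
        (\<Sum>i\<in>UNIV. \<Sum>j\<in>UNIV. Gp $ i $ j * d\<phi> a i * d\<phi> b j)
      - (1/2) * g x $ a $ b * (\<Sum>i\<in>UNIV. \<Sum>j\<in>UNIV. \<Sum>c\<in>UNIV. \<Sum>d\<in>UNIV.
             Gp $ i $ j * gi $ c $ d * d\<phi> c i * d\<phi> d j)
      + 2 * (\<Sum>L\<in>UNIV. \<Sum>S\<in>UNIV. \<Sum>c\<in>UNIV. \<Sum>d\<in>UNIV.
             Ip $ L $ S * F L $ a $ c * gi $ c $ d * F S $ b $ d)
      - (1/2) * g x $ a $ b * (\<Sum>L\<in>UNIV. \<Sum>S\<in>UNIV. \<Sum>c\<in>UNIV. \<Sum>d\<in>UNIV. \<Sum>e\<in>UNIV. \<Sum>h\<in>UNIV.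
             Ip $ L $ S * F L $ c $ d * gi $ c $ e * gi $ d $ h * F S $ e $ h)))"

definition scalar_eq :: "(real^'s::finite \<Rightarrow> real^'s^'s) \<Rightarrow> (real^'s \<Rightarrow> real^('v::finite + 'v)^('v + 'v))
    \<Rightarrow> ('s, 'v) field \<Rightarrow> real^4 \<Rightarrow> bool" where
  "scalar_eq G J c x = (case c of (g, \<phi>, \<V>) \<Rightarrow>
     let gi = matrix_inv (g x); d\<phi> = (\<lambda>a i. pd \<phi> a x $ i); F = Ffld \<V> x;
         W = (\<lambda>k y a. \<Sum>b\<in>UNIV. \<Sum>i\<in>UNIV. matrix_inv (g y) $ a $ b * G (\<phi> y) $ i $ k * pd \<phi> b y $ i) in
     (\<forall>k. (\<Sum>a\<in>UNIV. pd (\<lambda>y. W k y a) a x) + (\<Sum>a\<in>UNIV. \<Sum>b\<in>UNIV. christ g x a a b * W k x b) =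
        (1/2) * (\<Sum>i\<in>UNIV. \<Sum>j\<in>UNIV. \<Sum>c\<in>UNIV. \<Sum>d\<in>UNIV.
             pd (\<lambda>q. G q $ i $ j) k (\<phi> x) * d\<phi> c i * gi $ c $ d * d\<phi> d j)
      + (1/2) * (\<Sum>L\<in>UNIV. \<Sum>S\<in>UNIV. \<Sum>a\<in>UNIV. \<Sum>b\<in>UNIV. \<Sum>c\<in>UNIV. \<Sum>d\<in>UNIV.
             pd (\<lambda>q. R_of (J q) $ L $ S) k (\<phi> x) * F L $ a $ b * gi $ a $ c * gi $ b $ d
               * hodge (g x) (F S) $ c $ d)
      + (1/2) * (\<Sum>L\<in>UNIV. \<Sum>S\<in>UNIV. \<Sum>a\<in>UNIV. \<Sum>b\<in>UNIV. \<Sum>c\<in>UNIV. \<Sum>d\<in>UNIV.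
             pd (\<lambda>q. I_of (J q) $ L $ S) k (\<phi> x) * F L $ a $ b * gi $ a $ c * gi $ b $ d
               * F S $ c $ d)))"

definition maxwell_eq :: "('s::finite, 'v::finite) field \<Rightarrow> real^4 \<Rightarrow> bool" where
  "maxwell_eq c x = (case c of (g, \<phi>, \<V>) \<Rightarrow>
     (\<forall>P a b e. pd (\<lambda>y. \<V> y $ b $ e $ P) a x + pd (\<lambda>y. \<V> y $ e $ a $ P) b x
               + pd (\<lambda>y. \<V> y $ a $ b $ P) e x = 0))"

definition Sol :: "(real^4) set \<Rightarrow> (real^'s::finite) set \<Rightarrow> (real^'s \<Rightarrow> real^'s^'s)
    \<Rightarrow> (real^'s \<Rightarrow> real^('v::finite + 'v)^('v + 'v)) \<Rightarrow> ('s, 'v) field set" where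
  "Sol U V G J = {c \<in> Conf U V G J.
     \<forall>x\<in>U. einstein_eq G J c x \<and> scalar_eq G J c x \<and> maxwell_eq c x}"

definition Amap :: "(real^4) set \<Rightarrow> (real^'s::finite \<Rightarrow> real^'s) \<Rightarrow> real^('v::finite + 'v)^('v + 'v)
    \<Rightarrow> ('s, 'v) field \<Rightarrow> ('s, 'v) field" where
  "Amap U f A c = (case c of (g, \<phi>, \<V>) \<Rightarrow>
     (g, (\<lambda>x. if x \<in> U then f (\<phi> x) else undefined),
         (\<lambda>x. if x \<in> U then (\<chi> a b. A *v (\<V> x $ a $ b)) else undefined)))"

end

theory Submission
  imports Defs
begin

text \<open>
  On the configuration space the electromagnetic part of the Einstein equations is the contraction of
  \<open>omega (\<V>\<^sub>a\<^sub>c, J \<V>\<^sub>b\<^sub>d)\<close> with the inverse metric, and the electromagnetic source of the scalar equation is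
  a quarter of the full contraction of \<open>omega (\<V>\<^sub>a\<^sub>b, (\<partial>\<^sub>k J) \<V>\<^sub>c\<^sub>d)\<close>. Both rest on the identities
  \<open>\<star>F\<^sub>a\<^sub>c \<star>H\<^sub>b\<^sup>c = H\<^sub>a\<^sub>c F\<^sub>b\<^sup>c - (1/2) g\<^sub>a\<^sub>b F\<cdot>H\<close> and \<open>\<star>\<star> = -1\<close> of Lorentzian Hodge duality on 2-forms. In this form
  invariance under \<open>Sp\<close> is manifest, so every field equation is carried pointwise to its transform: the
  Einstein equations agree term by term, the Maxwell equations are multiplied by the symplectic matrix, and the
  scalar equations by the transposed Jacobian of \<open>f\<close>. In the last case the second derivatives of \<open>f\<close> cancel
  because they commute.
\<close>

subsection \<open>Calculus of smooth functions\<close>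

text \<open>Under \<open>Sp\<close> the matrices \<open>I_of\<close> and \<open>R_of\<close>
  transform together by a fractional linear rule, whereas \<open>J\<close> is only conjugated by a
  constant matrix. Comparing the equations as they are given would mean differentiating the former
  rule, since the scalar equations contain derivatives of both matrices. This is avoided by
  differentiating the block identities \<open>I_of M ** UR M = mat 1\<close>,
  \<open>R_of M = - (I_of M ** UL M)\<close>, \<open>LR M = R_of M ** UR M\<close> and
  \<open>LL M = - I_of M + R_of M ** UL M\<close>, which hold on all of \<open>V\<close> and tie the
  derivatives of \<open>I_of\<close> and \<open>R_of\<close> to that of \<open>J\<close>. The
  numerical factors of the equations are what makes the covariant form possible: the symplectic
  pairing counts F and its Hodge dual alike, and duality makes both counts equal up to a trace. Each
  field equation is shown equivalent to its transform, not merely to imply it. Surjectivity onto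
  solutions then comes from the bijection of configurations, and no iterated push-forward has to be
  identified with the original metric.\<close>

lemma pder_snoc: "pder (ds @ [d]) f = pder ds (\<lambda>x. frechet_derivative f (at x) d)"
  by (induction ds) auto

text \<open>Grades smoothness by order, because the product and chain rules return undifferentiated
  factors too, so an induction must control all lower orders at once. The derivative is peeled off
  at the inner end, the one exposed by \<open>pder_snoc\<close>: order \<open>Suc n\<close> is then
  order \<open>n\<close> for the directional derivatives.\<close>

fun diff_upto :: "nat \<Rightarrow> 'a::euclidean_space set \<Rightarrow> ('a \<Rightarrow> 'b::real_normed_vector) \<Rightarrow> bool" where
  "diff_upto 0 S f \<longleftrightarrow> f differentiable_on S"
| "diff_upto (Suc n) S f \<longleftrightarrow> f differentiable_on S \<and> (\<forall>d. diff_upto n S (\<lambda>x. frechet_derivative f (at x) d))"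

lemma diff_upto_differentiable_on: "diff_upto n S f \<Longrightarrow> f differentiable_on S"
  by (cases n) auto

lemma diff_upto_Suc_D: "diff_upto (Suc n) S f \<Longrightarrow> diff_upto n S f"
proof (induction n arbitrary: f)
  case (Suc n)
  have "diff_upto n S (\<lambda>x. frechet_derivative f (at x) d)" for d
    by (rule Suc.IH) (use Suc.prems in \<open>simp only: diff_upto.simps(2)[of "Suc n"]\<close>)
  with diff_upto_differentiable_on[OF Suc.prems] show ?case by simp
qed auto

lemma diff_upto_pder: "diff_upto n S f \<longleftrightarrow> (\<forall>ds. length ds \<le> n \<longrightarrow> pder ds f differentiable_on S)"
proof (induction n arbitrary: f)
  case (Suc n)
  have "(\<forall>ds. length ds \<le> Suc n \<longrightarrow> pder ds f differentiable_on S) \<longleftrightarrow>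
      f differentiable_on S \<and> (\<forall>d ds. length ds \<le> n \<longrightarrow> pder (ds @ [d]) f differentiable_on S)"
    (is "?L \<longleftrightarrow> ?R")
  proof
    assume L: ?L
    show ?R using L[rule_format, of "[]"] L by auto
  next
    assume R: ?R
    show ?L
    proof (intro allI impI)
      fix ds :: "'a list" assume "length ds \<le> Suc n"
      with R show "pder ds f differentiable_on S"
        by (cases ds rule: rev_cases) auto
    qed
  qed
  with Suc show ?case by (simp add: pder_snoc)
qed auto

lemma smooth_on_diff_upto: "smooth_on S f \<longleftrightarrow> (\<forall>n. diff_upto n S f)"
  unfolding smooth_on_def diff_upto_pder by auto

lemma diff_upto_cong:
  assumes "open S" "\<And>x. x \<in> S \<Longrightarrow> f x = g x" "diff_upto n S f"
  shows "diff_upto n S g"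
  using assms(2,3)
proof (induction n arbitrary: f g)
  case 0
  then show ?case by (metis differentiable_on_def differentiable_transform_within diff_upto.simps(1) zero_less_one)
next
  case (Suc n)
  have fd: "f differentiable_on S" using Suc.prems by auto
  have gd: "g differentiable_on S"
    using fd Suc.prems(1) by (metis differentiable_on_def differentiable_transform_within zero_less_one)
  have "frechet_derivative f (at x) d = frechet_derivative g (at x) d" if "x \<in> S" for x d
    by (metis Suc.prems(1) assms(1) fd differentiable_on_eq_differentiable_at frechet_derivative_transform_within_open that)
  then have "diff_upto n S (\<lambda>x. frechet_derivative g (at x) d)" for d
    by (rule Suc.IH) (use Suc.prems(2) in auto)
  with gd show ?case by simp
qed

lemma frechet_derivative_eqI:
  "(f has_derivative f') (at x) \<Longrightarrow> frechet_derivative f (at x) d = f' d"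
  by (metis frechet_derivative_at)

lemma diff_upto_has_derivative:
  "open S \<Longrightarrow> diff_upto n S f \<Longrightarrow> x \<in> S \<Longrightarrow> (f has_derivative frechet_derivative f (at x)) (at x)"
  by (metis diff_upto_differentiable_on differentiable_on_eq_differentiable_at frechet_derivative_works)

lemma diff_upto_SucI:
  assumes "open S" "\<And>x. x \<in> S \<Longrightarrow> (f has_derivative f' x) (at x)" "\<And>d. diff_upto n S (\<lambda>x. f' x d)"
  shows "diff_upto (Suc n) S f"
proof -
  have "f differentiable_on S"
    using assms(2) by (auto intro: differentiableI differentiable_at_withinI simp: differentiable_on_def)
  moreover have "diff_upto n S (\<lambda>x. frechet_derivative f (at x) d)" for d
    by (rule diff_upto_cong[OF assms(1) _ assms(3)[of d]]) (simp add: frechet_derivative_eqI[OF assms(2)])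
  ultimately show ?thesis by simp
qed

lemma diff_upto_bounded_linear:
  assumes "open S" "bounded_linear L" "diff_upto n S f"
  shows "diff_upto n S (\<lambda>x. L (f x))"
  using assms(3)
proof (induction n arbitrary: f)
  case 0
  then show ?case using assms(2)
    by (auto simp: differentiable_on_def differentiable_def intro: bounded_linear.has_derivative)
next
  case (Suc n)
  show ?case
  proof (rule diff_upto_SucI[OF assms(1)])
    show "((\<lambda>x. L (f x)) has_derivative (\<lambda>d. L (frechet_derivative f (at x) d))) (at x)" if "x \<in> S" for x
      by (rule bounded_linear.has_derivative[OF assms(2) diff_upto_has_derivative[OF assms(1) Suc.prems that]])
  qed (use Suc in auto)
qed

lemma diff_upto_add:
  assumes "open S" "diff_upto n S f" "diff_upto n S g"
  shows "diff_upto n S (\<lambda>x. f x + g x)"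
  using assms(2,3)
proof (induction n arbitrary: f g)
  case (Suc n)
  show ?case
    by (rule diff_upto_SucI[OF assms(1) has_derivative_add[OF
        diff_upto_has_derivative[OF assms(1) Suc.prems(1)] diff_upto_has_derivative[OF assms(1) Suc.prems(2)]]])
      (use Suc in auto)
qed auto

lemma diff_upto_const: "diff_upto n S (\<lambda>x. c)"
  by (induction n arbitrary: c) auto

lemma diff_upto_sum:
  assumes "open S" "finite I" "\<And>i. i \<in> I \<Longrightarrow> diff_upto n S (f i)"
  shows "diff_upto n S (\<lambda>x. \<Sum>i\<in>I. f i x)"
  using assms(2,3) by (induction I) (auto simp: diff_upto_const intro: diff_upto_add[OF assms(1)])

lemma diff_upto_scaleR:
  assumes "open S" "diff_upto n S f" "diff_upto n S g"
  shows "diff_upto n S (\<lambda>x. f x *\<^sub>R g x)"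
  using assms(2,3)
proof (induction n arbitrary: f g)
  case (Suc n)
  show ?case
  proof (rule diff_upto_SucI[OF assms(1) has_derivative_scaleR[OF
        diff_upto_has_derivative[OF assms(1) Suc.prems(1)] diff_upto_has_derivative[OF assms(1) Suc.prems(2)]]])
    show "diff_upto n S (\<lambda>x. f x *\<^sub>R frechet_derivative g (at x) d + frechet_derivative f (at x) d *\<^sub>R g x)" for d
      by (rule diff_upto_add[OF assms(1)]; rule Suc.IH)
        (use Suc.prems diff_upto_Suc_D[OF Suc.prems(1)] diff_upto_Suc_D[OF Suc.prems(2)] in auto)
  qed
qed auto

lemma diff_upto_compose:
  fixes \<phi> :: "'a::euclidean_space \<Rightarrow> 'b::euclidean_space" and f :: "'b \<Rightarrow> 'c::real_normed_vector"
  assumes S: "open S" and T: "open T" and im: "\<phi> ` S \<subseteq> T"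
    and "diff_upto n S \<phi>" "diff_upto n T f"
  shows "diff_upto n S (\<lambda>x. f (\<phi> x))"
  using assms(4,5)
proof (induction n arbitrary: f)
  case 0
  then show ?case using im
    by (auto intro: differentiable_on_compose differentiable_on_subset)
next
  case (Suc n)
  let ?f = "\<lambda>x. frechet_derivative f (at (\<phi> x))" and ?\<phi> = "\<lambda>x. frechet_derivative \<phi> (at x)"
  have D: "((\<lambda>x. f (\<phi> x)) has_derivative (\<lambda>d. \<Sum>b\<in>Basis. (?\<phi> x d \<bullet> b) *\<^sub>R ?f x b)) (at x)"
    if "x \<in> S" for x
  proof -
    have df: "(f has_derivative ?f x) (at (\<phi> x))"
      by (rule diff_upto_has_derivative[OF T Suc.prems(2)]) (use that im in auto)
    have "((\<lambda>x. f (\<phi> x)) has_derivative (\<lambda>d. ?f x (?\<phi> x d))) (at x)"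
      by (rule has_derivative_compose[OF diff_upto_has_derivative[OF S Suc.prems(1) that] df])
    \<comment> \<open>The direction \<open>?\<phi> x d\<close> varies with \<open>x\<close>, while
      the induction hypothesis handles derivatives of \<open>f\<close> in fixed directions.
      Expansion in the basis gives scalar coefficients times such derivatives.\<close>
    moreover have "?f x (?\<phi> x d) = (\<Sum>b\<in>Basis. (?\<phi> x d \<bullet> b) *\<^sub>R ?f x b)" for d
    proof -
      have "linear (?f x)" using df has_derivative_linear by blast
      then have "?f x (\<Sum>b\<in>Basis. (?\<phi> x d \<bullet> b) *\<^sub>R b) = (\<Sum>b\<in>Basis. (?\<phi> x d \<bullet> b) *\<^sub>R ?f x b)"
        by (simp add: linear_sum linear_scale)
      then show ?thesis by (simp add: euclidean_representation)
    qed
    ultimately show ?thesis by simp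
  qed
  show ?case
  proof (rule diff_upto_SucI[OF S D])
    show "diff_upto n S (\<lambda>x. \<Sum>b\<in>Basis. (?\<phi> x d \<bullet> b) *\<^sub>R ?f x b)" for d
    proof (intro diff_upto_sum diff_upto_scaleR S finite_Basis)
      fix b :: 'b
      show "diff_upto n S (\<lambda>x. ?\<phi> x d \<bullet> b)"
        by (rule diff_upto_bounded_linear[OF S bounded_linear_inner_left]) (use Suc.prems in auto)
      show "diff_upto n S (\<lambda>x. ?f x b)"
        by (rule Suc.IH) (use Suc.prems diff_upto_Suc_D in auto)
    qed
  qed
qed

lemma smooth_on_cong:
  "open S \<Longrightarrow> (\<And>x. x \<in> S \<Longrightarrow> f x = g x) \<Longrightarrow> smooth_on S f \<Longrightarrow> smooth_on S g"
  unfolding smooth_on_diff_upto using diff_upto_cong by blast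

lemma smooth_on_compose:
  fixes \<phi> :: "'a::euclidean_space \<Rightarrow> 'b::euclidean_space"
  shows "open S \<Longrightarrow> open T \<Longrightarrow> \<phi> ` S \<subseteq> T \<Longrightarrow> smooth_on S \<phi> \<Longrightarrow> smooth_on T f \<Longrightarrow> smooth_on S (\<lambda>x. f (\<phi> x))"
  unfolding smooth_on_diff_upto using diff_upto_compose by blast

lemma smooth_on_bounded_linear:
  "open S \<Longrightarrow> bounded_linear L \<Longrightarrow> smooth_on S f \<Longrightarrow> smooth_on S (\<lambda>x. L (f x))"
  unfolding smooth_on_diff_upto using diff_upto_bounded_linear by blast

lemma smooth_on_frechet_derivative: "smooth_on S f \<Longrightarrow> smooth_on S (\<lambda>x. frechet_derivative f (at x) d)"
  unfolding smooth_on_diff_upto by (metis diff_upto.simps(2))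

lemma smooth_on_differentiable_at: "open S \<Longrightarrow> smooth_on S f \<Longrightarrow> x \<in> S \<Longrightarrow> f differentiable at x"
  unfolding smooth_on_diff_upto
  by (metis diff_upto_differentiable_on differentiable_on_eq_differentiable_at)

section \<open>Symmetry of second derivatives\<close>

lemma has_derivative_along_line:
  assumes "(f has_derivative f') (at (x + s *\<^sub>R u))"
  shows "((\<lambda>s. f (x + s *\<^sub>R u)) has_vector_derivative f' u) (at s)"
proof -
  have "((\<lambda>s. x + s *\<^sub>R u) has_derivative (\<lambda>h. h *\<^sub>R u)) (at s)"
    by (auto intro!: derivative_eq_intros)
  from has_derivative_compose[OF this assms]
  show ?thesis
    unfolding has_vector_derivative_def
    using linear_scale[OF has_derivative_linear[OF assms]] by simp
qed

text \<open>The mean value theorem is used twice: on the difference of \<open>f\<close> along two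
  parallel edges, as a function of \<open>s\<close>, and then on the derivative in direction
  \<open>u\<close> along \<open>v\<close>.\<close>

lemma second_difference_mvt:
  fixes f :: "'a::euclidean_space \<Rightarrow> real"
  assumes B: "\<And>s t. 0 \<le> s \<Longrightarrow> s \<le> h \<Longrightarrow> 0 \<le> t \<Longrightarrow> t \<le> h \<Longrightarrow> x + s *\<^sub>R u + t *\<^sub>R v \<in> S"
    and S: "open S" and f: "smooth_on S f" and h: "0 < h"
  obtains s t where "0 < s" "s < h" "0 < t" "t < h"
    "f (x + h *\<^sub>R u + h *\<^sub>R v) - f (x + h *\<^sub>R u) - f (x + h *\<^sub>R v) + f x =
      h * h * frechet_derivative (\<lambda>y. frechet_derivative f (at y) u) (at (x + s *\<^sub>R u + t *\<^sub>R v)) v"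
proof -
  let ?fu = "\<lambda>y. frechet_derivative f (at y) u"
  have D: "(g has_derivative frechet_derivative g (at y)) (at y)" if "smooth_on S g" "y \<in> S" for y and g :: "'a \<Rightarrow> real"
    using smooth_on_differentiable_at[OF S that] by (simp add: frechet_derivative_works)
  have fu: "smooth_on S ?fu" using f by (rule smooth_on_frechet_derivative)
  let ?p = "\<lambda>s. f (x + h *\<^sub>R v + s *\<^sub>R u) - f (x + s *\<^sub>R u)"
  have dp: "(?p has_real_derivative (?fu (x + h *\<^sub>R v + s *\<^sub>R u) - ?fu (x + s *\<^sub>R u))) (at s)"
    if "0 \<le> s" "s \<le> h" for s
    unfolding has_real_derivative_iff_has_vector_derivative
    using B[OF that, of h] B[OF that, of 0] h
    by (intro has_vector_derivative_diff has_derivative_along_line D[OF f]) (auto simp: algebra_simps)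
  obtain s where s: "0 < s" "s < h"
    "?p h - ?p 0 = (h - 0) * (?fu (x + h *\<^sub>R v + s *\<^sub>R u) - ?fu (x + s *\<^sub>R u))"
    using MVT2[OF h dp] by blast
  let ?q = "\<lambda>t. ?fu (x + s *\<^sub>R u + t *\<^sub>R v)"
  have dq: "(?q has_real_derivative frechet_derivative ?fu (at (x + s *\<^sub>R u + t *\<^sub>R v)) v) (at t)"
    if "0 \<le> t" "t \<le> h" for t
    unfolding has_real_derivative_iff_has_vector_derivative
    using B[of s t] s that
    by (intro has_derivative_along_line D[OF fu]) (auto simp: algebra_simps)
  obtain t where t: "0 < t" "t < h"
    "?q h - ?q 0 = (h - 0) * frechet_derivative ?fu (at (x + s *\<^sub>R u + t *\<^sub>R v)) v"
    using MVT2[OF h dq] by blast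
  show ?thesis
    by (rule that[OF s(1,2) t(1,2)]) (use s(3) t(3) in \<open>simp add: algebra_simps\<close>)
qed

text \<open>The second difference is symmetric in \<open>u\<close> and \<open>v\<close>, so the mean
  value argument in both orders equates the two mixed derivatives at nearby points; their continuity
  at \<open>x\<close> does the rest.\<close>

lemma frechet_derivative_commute:
  fixes f :: "'a::euclidean_space \<Rightarrow> real"
  assumes S: "open S" and f: "smooth_on S f" and x: "x \<in> S"
  shows "frechet_derivative (\<lambda>y. frechet_derivative f (at y) u) (at x) v =
         frechet_derivative (\<lambda>y. frechet_derivative f (at y) v) (at x) u"
proof (rule ccontr)
  let ?D = "\<lambda>u v y. frechet_derivative (\<lambda>y. frechet_derivative f (at y) u) (at y) v"
  \<comment> \<open>Half the gap: two errors below \<open>e\<close> cannot bridge a distance of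
    \<open>2 * e\<close>.\<close>
  define e where "e = \<bar>?D u v x - ?D v u x\<bar> / 2"
  assume "?D u v x \<noteq> ?D v u x"
  then have e: "e > 0" by (simp add: e_def)
  have cont: "isCont (?D u v) x" for u v
    by (intro differentiable_imp_continuous_within smooth_on_differentiable_at[OF S _ x]
        smooth_on_frechet_derivative f)
  have "\<forall>\<^sub>F y in at x. dist (?D u v y) (?D u v x) < e \<and> dist (?D v u y) (?D v u x) < e \<and> y \<in> S"
    using cont[of u v] cont[of v u] e S x
    unfolding continuous_within tendsto_iff by (intro eventually_conj) (auto simp: eventually_at_in_open')
  then obtain r where r: "r > 0" "\<And>y. y \<noteq> x \<Longrightarrow> dist y x < r \<Longrightarrow>
      dist (?D u v y) (?D u v x) < e \<and> dist (?D v u y) (?D v u x) < e \<and> y \<in> S"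
    unfolding eventually_at by auto
  then have near: "dist (?D u v y) (?D u v x) < e \<and> dist (?D v u y) (?D v u x) < e \<and> y \<in> S"
    if "dist y x < r" for y
    using that e x by (cases "y = x") auto
  \<comment> \<open>Keeps the whole parallelogram within distance \<open>r\<close> of
    \<open>x\<close>; the summand 1 makes the denominator positive even if both directions
    vanish.\<close>
  define h where "h = r / (2 * (norm u + norm v + 1))"
  have pos: "norm u + norm v + 1 > 0" by (simp add: add_nonneg_pos)
  have h: "h > 0" using r(1) pos by (simp add: h_def)
  have hr: "h * (norm u + norm v) < r"
  proof -
    have "h * (norm u + norm v) < h * (2 * (norm u + norm v + 1))"
      using h by (intro mult_strict_left_mono) (auto simp: add_nonneg_pos)
    also have "\<dots> = r" using pos by (simp add: h_def)
    finally show ?thesis .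
  qed
  have close: "dist (x + s *\<^sub>R a + t *\<^sub>R b) x < r"
    if "0 \<le> s" "s \<le> h" "0 \<le> t" "t \<le> h" "{a, b} = {u, v}" for s t a b
  proof -
    have "dist (x + s *\<^sub>R a + t *\<^sub>R b) x = norm (s *\<^sub>R a + t *\<^sub>R b)"
      by (simp add: dist_norm add.assoc)
    also have "\<dots> \<le> s * norm a + t * norm b"
      using norm_triangle_ineq[of "s *\<^sub>R a" "t *\<^sub>R b"] that by simp
    also have "\<dots> \<le> h * norm a + h * norm b"
      using that by (intro add_mono mult_right_mono) auto
    also have "\<dots> = h * (norm u + norm v)"
      using that(5) by (auto simp: doubleton_eq_iff algebra_simps)
    finally show ?thesis using hr by simp
  qed
  obtain s t where st: "0 < s" "s < h" "0 < t" "t < h"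
    "f (x + h *\<^sub>R u + h *\<^sub>R v) - f (x + h *\<^sub>R u) - f (x + h *\<^sub>R v) + f x = h * h * ?D u v (x + s *\<^sub>R u + t *\<^sub>R v)"
    by (rule second_difference_mvt[OF _ S f h, of x u v]) (use near close in auto)
  obtain s' t' where st': "0 < s'" "s' < h" "0 < t'" "t' < h"
    "f (x + h *\<^sub>R v + h *\<^sub>R u) - f (x + h *\<^sub>R v) - f (x + h *\<^sub>R u) + f x = h * h * ?D v u (x + s' *\<^sub>R v + t' *\<^sub>R u)"
    by (rule second_difference_mvt[OF _ S f h, of x v u]) (use near close in \<open>auto simp: insert_commute\<close>)
  have "h * h * ?D u v (x + s *\<^sub>R u + t *\<^sub>R v) = h * h * ?D v u (x + s' *\<^sub>R v + t' *\<^sub>R u)"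
    using st(5) st'(5) by (simp add: algebra_simps)
  then have "?D u v (x + s *\<^sub>R u + t *\<^sub>R v) = ?D v u (x + s' *\<^sub>R v + t' *\<^sub>R u)"
    using h by simp
  moreover have "\<bar>?D u v (x + s *\<^sub>R u + t *\<^sub>R v) - ?D u v x\<bar> < e"
    using near[OF close[of s t u v]] st by (auto simp: dist_real_def)
  moreover have "\<bar>?D v u (x + s' *\<^sub>R v + t' *\<^sub>R u) - ?D v u x\<bar> < e"
    using near[OF close[of s' t' v u]] st' by (auto simp: dist_real_def insert_commute)
  moreover have False if "a = b" "\<bar>a - c\<bar> < \<bar>c - d\<bar> / 2" "\<bar>b - d\<bar> < \<bar>c - d\<bar> / 2" for a b c d :: real
    using that by (simp add: abs_if split: if_splits)
  ultimately show False unfolding e_def by blast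
qed

section \<open>Differentiability of determinants and inverse matrices\<close>

lemma differentiable_prod:
  fixes f :: "'i \<Rightarrow> 'a::real_normed_vector \<Rightarrow> real"
  assumes "\<And>i. i \<in> I \<Longrightarrow> f i differentiable at x"
  shows "(\<lambda>y. \<Prod>i\<in>I. f i y) differentiable at x"
  using assms by (induction I rule: infinite_finite_induct) auto

lemma differentiable_det:
  fixes B :: "'a::real_normed_vector \<Rightarrow> real^'n^'n"
  assumes "\<And>i j. (\<lambda>y. B y $ i $ j) differentiable at x"
  shows "(\<lambda>y. det (B y)) differentiable at x"
  unfolding det_def
  by (intro differentiable_sum ballI differentiable_mult differentiable_prod differentiable_const assms) auto

lemma matrix_inv:
  fixes M :: "'a::semiring_1^'n^'n"
  assumes "invertible M"
  shows matrix_inv_right: "M ** matrix_inv M = mat 1" and matrix_inv_left: "matrix_inv M ** M = mat 1"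
  using someI_ex[OF assms[unfolded invertible_def]] unfolding matrix_inv_def by auto

text \<open>Exhibits the entries of the inverse as quotients of determinants, hence of polynomials,
  from which differentiability of inversion is read off.\<close>

lemma matrix_inv_cramer:
  fixes M :: "real^'n^'n"
  assumes "det M \<noteq> 0"
  shows "matrix_inv M $ k $ l = det (\<chi> i j. if j = k then axis l 1 $ i else M $ i $ j) / det M"
proof -
  have "M ** matrix_inv M = mat 1"
    using assms invertible_det_nz matrix_inv_right by blast
  then have "M *v (matrix_inv M *v axis l 1) = axis l 1"
    by (simp add: matrix_vector_mul_assoc)
  then have "matrix_inv M *v axis l 1 = (\<chi> k. det (\<chi> i j. if j = k then axis l 1 $ i else M $ i $ j) / det M)"
    using cramer[OF assms] by blast
  then have "column l (matrix_inv M) $ k = det (\<chi> i j. if j = k then axis l 1 $ i else M $ i $ j) / det M"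
    by (simp add: matrix_vector_mult_basis)
  then show ?thesis by (simp add: column_def)
qed

lemma differentiable_matrix_inv:
  fixes B :: "'a::real_normed_vector \<Rightarrow> real^'n^'n"
  assumes B: "\<And>i j. (\<lambda>y. B y $ i $ j) differentiable at x" and d: "det (B x) \<noteq> 0"
  shows "(\<lambda>y. matrix_inv (B y) $ k $ l) differentiable at x"
proof -
  let ?C = "\<lambda>y. (\<chi> i j. if j = k then axis l 1 $ i else B y $ i $ j) :: real^'n^'n"
  have "(\<lambda>y. ?C y $ i $ j) differentiable at x" for i j
    using B by (cases "j = k") auto
  then have q: "(\<lambda>y. det (?C y) / det (B y)) differentiable at x"
    by (intro differentiable_divide differentiable_det B d)
  have "isCont (\<lambda>y. det (B y)) x"
    by (intro differentiable_imp_continuous_within differentiable_det B)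
  \<comment> \<open>Cramer's quotient is known to be the inverse only where the determinant does not
    vanish, so the derivative is transferred through an equality near \<open>x\<close>.\<close>
  then have "\<forall>\<^sub>F y in at x. det (B y) \<noteq> 0"
    using d by (simp add: continuous_within tendsto_imp_eventually_ne)
  then have "\<forall>\<^sub>F y in at x. det (?C y) / det (B y) = matrix_inv (B y) $ k $ l"
    by eventually_elim (simp add: matrix_inv_cramer)
  moreover have "det (?C x) / det (B x) = matrix_inv (B x) $ k $ l"
    by (simp add: matrix_inv_cramer[OF d])
  moreover obtain D where D: "((\<lambda>y. det (?C y) / det (B y)) has_derivative D) (at x)"
    using q unfolding differentiable_def by blast
  ultimately have "((\<lambda>y. matrix_inv (B y) $ k $ l) has_derivative D) (at x)"
    by (auto intro: has_derivative_transform_eventually[OF D])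
  then show ?thesis by (rule differentiableI)
qed

subsection \<open>Hodge duality in dimension four\<close>

lemma det_4:
  "det (A::'a::comm_ring_1^4^4) =
     A$1$1 * A$2$2 * A$3$3 * A$4$4 - A$1$1 * A$2$2 * A$3$4 * A$4$3
   - A$1$1 * A$2$3 * A$3$2 * A$4$4 + A$1$1 * A$2$3 * A$3$4 * A$4$2
   + A$1$1 * A$2$4 * A$3$2 * A$4$3 - A$1$1 * A$2$4 * A$3$3 * A$4$2
   - A$1$2 * A$2$1 * A$3$3 * A$4$4 + A$1$2 * A$2$1 * A$3$4 * A$4$3
   + A$1$2 * A$2$3 * A$3$1 * A$4$4 - A$1$2 * A$2$3 * A$3$4 * A$4$1
   - A$1$2 * A$2$4 * A$3$1 * A$4$3 + A$1$2 * A$2$4 * A$3$3 * A$4$1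
   + A$1$3 * A$2$1 * A$3$2 * A$4$4 - A$1$3 * A$2$1 * A$3$4 * A$4$2
   - A$1$3 * A$2$2 * A$3$1 * A$4$4 + A$1$3 * A$2$2 * A$3$4 * A$4$1
   + A$1$3 * A$2$4 * A$3$1 * A$4$2 - A$1$3 * A$2$4 * A$3$2 * A$4$1
   - A$1$4 * A$2$1 * A$3$2 * A$4$3 + A$1$4 * A$2$1 * A$3$3 * A$4$2
   + A$1$4 * A$2$2 * A$3$1 * A$4$3 - A$1$4 * A$2$2 * A$3$3 * A$4$1
   - A$1$4 * A$2$3 * A$3$1 * A$4$2 + A$1$4 * A$2$3 * A$3$2 * A$4$1"
proof -
  have f1: "finite {2::4, 3, 4}" "1 \<notin> {2::4, 3, 4}" by auto
  have f2: "finite {3::4, 4}" "2 \<notin> {3::4, 4}" by auto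
  have f3: "finite {4::4}" "3 \<notin> {4::4}" by auto
  show ?thesis
    unfolding det_def UNIV_4
    unfolding sum_over_permutations_insert[OF f1]
    unfolding sum_over_permutations_insert[OF f2]
    unfolding sum_over_permutations_insert[OF f3]
    unfolding permutes_sing
    by (simp add: sign_swap_id permutation_swap_id permutation_compose sign_compose sign_id swap_id_eq algebra_simps)
qed

text \<open>In the type \<open>4\<close> the numerals 0 and 4 denote the same element, and sums and
  determinants are expanded over 1, 2, 3, 4. The leading index, written 0 in \<open>eps\<close>,
  therefore has to be renamed to 4.\<close>

lemma eps_4: "eps a b c d = det (\<chi> i::4. axis (if i = 4 then a else if i = 1 then b else if i = 2 then c else d) 1 :: real^4^4)"
proof -
  have "(4::4) = 0" by simp
  then show ?thesis by (simp only: eps_def)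
qed

text \<open>The part of the Hodge star that does not involve the metric. It turns raised indices
  into lowered ones; the metric enters only through the raising and a density factor.\<close>

definition dual2 :: "real^4^4 \<Rightarrow> real^4^4" where
  "dual2 X = (\<chi> a b. (1/2) * (\<Sum>c\<in>UNIV. \<Sum>d\<in>UNIV. eps a b c d * X $ c $ d))"

lemma skew_4:
  assumes "\<forall>a b. (X::real^4^4) $ a $ b = - X $ b $ a"
  shows "X$1$1 = 0" "X$2$2 = 0" "X$3$3 = 0" "X$4$4 = 0"
    "X$2$1 = - X$1$2" "X$3$1 = - X$1$3" "X$4$1 = - X$1$4" "X$3$2 = - X$2$3" "X$4$2 = - X$2$4" "X$4$3 = - X$3$4"
  using assms by (smt (verit))+

lemma dual2_skew_4:
  assumes "\<forall>a b. (X::real^4^4) $ a $ b = - X $ b $ a"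
  shows "dual2 X $ a $ b =
    (if a = 4 \<and> b = 1 then X$2$3 else if a = 1 \<and> b = 4 then - X$2$3
     else if a = 4 \<and> b = 2 then - X$1$3 else if a = 2 \<and> b = 4 then X$1$3
     else if a = 4 \<and> b = 3 then X$1$2 else if a = 3 \<and> b = 4 then - X$1$2
     else if a = 1 \<and> b = 2 then - X$3$4 else if a = 2 \<and> b = 1 then X$3$4
     else if a = 1 \<and> b = 3 then X$2$4 else if a = 3 \<and> b = 1 then - X$2$4
     else if a = 2 \<and> b = 3 then - X$1$4 else if a = 3 \<and> b = 2 then X$1$4 else 0)"
  using exhaust_4[of a] exhaust_4[of b]
  by (elim disjE; simp add: dual2_def sum_4 eps_4 det_4 axis_def skew_4[OF assms])


lemma dual2_skew: "dual2 X $ a $ b = - dual2 X $ b $ a" if "\<forall>a b. X $ a $ b = - X $ b $ a"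
  using exhaust_4[of a] exhaust_4[of b]
  by (elim disjE; simp add: dual2_skew_4[OF that])

lemma dual2_dual2: "dual2 (dual2 X) = X" if "\<forall>a b. X $ a $ b = - X $ b $ a"
proof -
  have "\<forall>a b. dual2 X $ a $ b = - dual2 X $ b $ a" using dual2_skew[OF that] by blast
  from dual2_skew_4[OF this] show ?thesis
    by (simp add: vec_eq_iff forall_4 dual2_skew_4[OF that] skew_4[OF that])
qed

text \<open>Matrix form of the contraction of two Levi-Civita symbols over one shared index, checked
  entry by entry. The reversed order \<open>Y ** X\<close> is why \<open>F\<close> and
  \<open>H\<close> change places in \<open>hodge_contract\<close>.\<close>

lemma dual2_mult_dual2:
  assumes X: "\<forall>a b. X $ a $ b = - X $ b $ a" and Y: "\<forall>a b. Y $ a $ b = - Y $ b $ a"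
  shows "dual2 X ** dual2 Y = - (Y ** X) - ((1/2) * (\<Sum>a\<in>UNIV. \<Sum>b\<in>UNIV. X $ a $ b * Y $ a $ b)) *\<^sub>R mat 1"
  by (simp add: vec_eq_iff forall_4 matrix_matrix_mult_def sum_4 dual2_skew_4[OF X] dual2_skew_4[OF Y] mat_def skew_4[OF X] skew_4[OF Y] algebra_simps)

lemma det_eps:
  "(\<Sum>c\<in>UNIV. \<Sum>d\<in>UNIV. \<Sum>e\<in>UNIV. \<Sum>h\<in>UNIV. eps c d e h * (p $ c * q $ d * r $ e * s $ h)) =
   det (\<chi> i::4. if i = 4 then p else if i = 1 then q else if i = 2 then r else s)"
  by (simp add: sum_4 eps_4 det_4 axis_def)

text \<open>The contraction is the determinant of four chosen columns of \<open>N\<close>. Choosing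
  them amounts to multiplying \<open>transpose N\<close> by a matrix of unit rows, so
  multiplicativity of \<open>det\<close> separates the two factors.\<close>

lemma eps_columns:
  "(\<Sum>c\<in>UNIV. \<Sum>d\<in>UNIV. \<Sum>e\<in>UNIV. \<Sum>h\<in>UNIV. eps c d e h * (N $ c $ a * N $ d $ b * N $ e $ k * N $ h $ l)) =
   det N * eps a b k l"
proof -
  let ?E = "\<chi> i::4. axis (if i = 4 then a else if i = 1 then b else if i = 2 then k else l) 1 :: real^4^4"
  have "(\<chi> i::4. if i = 4 then column a N else if i = 1 then column b N else if i = 2 then column k N else column l N)
     = ?E ** transpose N"
    by (simp add: vec_eq_iff matrix_matrix_mult_def transpose_def column_def axis_def if_distrib[of "\<lambda>x. x * _"] sum.delta' cong: if_cong)
  then have "det (\<chi> i::4. if i = 4 then column a N else if i = 1 then column b N else if i = 2 then column k N else column l N)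
     = eps a b k l * det N"
    by (simp add: det_mul det_transpose eps_4)
  then show ?thesis
    using det_eps[of "column a N" "column b N" "column k N" "column l N"]
    by (simp add: column_def mult.commute)
qed


lemma sum_rotate4:
  "(\<Sum>k\<in>K. \<Sum>a\<in>A. \<Sum>b\<in>B. \<Sum>c\<in>C. \<Sum>d\<in>D. P k a b c d) =
   (\<Sum>a\<in>A. \<Sum>b\<in>B. \<Sum>c\<in>C. \<Sum>d\<in>D. \<Sum>k\<in>K. P k a b c d)"
  by (rule trans[OF sum.swap], rule sum.cong[OF refl])+ (rule refl)

lemma sum_swap22:
  "(\<Sum>a\<in>A. \<Sum>b\<in>B. \<Sum>c\<in>C. \<Sum>d\<in>D. P a b c d) = (\<Sum>c\<in>C. \<Sum>d\<in>D. \<Sum>a\<in>A. \<Sum>b\<in>B. P a b c d)"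
  by (rule trans[OF sum.cong[OF refl sum.swap]], rule trans[OF sum.swap], rule sum.cong[OF refl],
      rule trans[OF sum.cong[OF refl sum.swap]], rule sum.swap)

text \<open>Covariance of the dual under a change of basis; the determinant appears because the
  Levi-Civita symbol is a tensor density. This makes it possible to treat the star without passing
  to an orthonormal frame.\<close>

lemma dual2_congruence:
  "transpose N ** dual2 (N ** X ** transpose N) ** N = det N *\<^sub>R dual2 X"
proof -
  let ?f = "\<lambda>a b k l c d e h. eps c d e h * (N $ c $ a * N $ d $ b * N $ e $ k * N $ h $ l) * X $ k $ l"
  have "(transpose N ** dual2 (N ** X ** transpose N) ** N) $ a $ b = (det N *\<^sub>R dual2 X) $ a $ b" for a b
  proof -
    have "(transpose N ** dual2 (N ** X ** transpose N) ** N) $ a $ b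
      = (1/2) * (\<Sum>d\<in>UNIV. \<Sum>c\<in>UNIV. \<Sum>e\<in>UNIV. \<Sum>h\<in>UNIV. \<Sum>l\<in>UNIV. \<Sum>k\<in>UNIV. ?f a b k l c d e h)"
      by (simp add: matrix_matrix_mult_def transpose_def dual2_def sum_distrib_left sum_distrib_right
          sum_divide_distrib mult_ac)
    also have "\<dots> = (1/2) * (\<Sum>c\<in>UNIV. \<Sum>d\<in>UNIV. \<Sum>e\<in>UNIV. \<Sum>h\<in>UNIV. \<Sum>k\<in>UNIV. \<Sum>l\<in>UNIV. ?f a b k l c d e h)"
      by (rule arg_cong2[where f = "(*)", OF refl], rule trans[OF sum.swap], rule sum.cong[OF refl],
          rule sum.cong[OF refl], rule sum.cong[OF refl], rule sum.cong[OF refl], rule sum.swap)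
    also have "\<dots> = (1/2) * (\<Sum>k\<in>UNIV. \<Sum>l\<in>UNIV. \<Sum>c\<in>UNIV. \<Sum>d\<in>UNIV. \<Sum>e\<in>UNIV. \<Sum>h\<in>UNIV. ?f a b k l c d e h)"
      by (rule arg_cong2[where f = "(*)", OF refl], rule sym[OF trans[OF sum.cong[OF refl sum_rotate4] sum_rotate4]])
    also have "\<dots> = (1/2) * (\<Sum>k\<in>UNIV. \<Sum>l\<in>UNIV. det N * eps a b k l * X $ k $ l)"
      by (simp only: eps_columns[symmetric] sum_distrib_right)
    also have "\<dots> = (det N *\<^sub>R dual2 X) $ a $ b"
      by (simp add: dual2_def sum_distrib_left mult_ac)
    finally show ?thesis .
  qed
  then show ?thesis by (simp add: vec_eq_iff)
qed

section \<open>The Hodge star of a Lorentzian metric\<close>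

lemma hodge_dual2: "hodge M w = sqrt \<bar>det M\<bar> *\<^sub>R dual2 (matrix_inv M ** w ** transpose (matrix_inv M))" for w :: "real^4^4"
proof -
  have "(\<Sum>e\<in>UNIV. \<Sum>h\<in>UNIV. eps a b c d * matrix_inv M $ c $ e * matrix_inv M $ d $ h * w $ e $ h) =
      eps a b c d * (\<Sum>h\<in>UNIV. (\<Sum>e\<in>UNIV. matrix_inv M $ c $ e * w $ e $ h) * matrix_inv M $ d $ h)" for a b c d
    by (subst sum.swap) (simp add: sum_distrib_left sum_distrib_right mult_ac)
  then show ?thesis
    by (simp add: vec_eq_iff hodge_def dual2_def matrix_matrix_mult_def transpose_def)
qed

definition twoform_dot :: "real^4^4 \<Rightarrow> real^4^4 \<Rightarrow> real^4^4 \<Rightarrow> real" where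
  "twoform_dot N F H = (\<Sum>c\<in>UNIV. \<Sum>d\<in>UNIV. \<Sum>e\<in>UNIV. \<Sum>h\<in>UNIV. F $ c $ d * N $ c $ e * N $ d $ h * H $ e $ h)"

lemma twoform_dot_matrix:
  "twoform_dot N F H = (\<Sum>c\<in>UNIV. \<Sum>d\<in>UNIV. F $ c $ d * (N ** H ** transpose N) $ c $ d)"
proof -
  have "(\<Sum>e\<in>UNIV. \<Sum>h\<in>UNIV. F $ c $ d * N $ c $ e * N $ d $ h * H $ e $ h) = F $ c $ d * (N ** H ** transpose N) $ c $ d" for c d
    by (subst sum.swap) (simp add: matrix_matrix_mult_def transpose_def sum_distrib_left sum_distrib_right mult_ac)
  then show ?thesis by (simp add: twoform_dot_def)
qed

lemma skew_transpose: "(\<forall>a b. X $ a $ b = - X $ b $ a) \<longleftrightarrow> transpose X = - (X :: real^4^4)"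
  by (simp add: vec_eq_iff transpose_def) (metis minus_equation_iff)

lemma det_lorentz_diag: "det lorentz_diag = -1"
proof -
  have "(4::4) = 0" by simp
  then have "lorentz_diag $ i $ j = (if i = j then (if i = 4 then -1 else 1) else 0)" for i j
    by (simp only: lorentz_diag_def vec_lambda_beta)
  then show ?thesis by (simp add: det_4)
qed

lemma is_lorentzian_det_neg: assumes "is_lorentzian M" shows "det M < 0"
proof -
  obtain P where P: "invertible P" "transpose P ** M ** P = lorentz_diag"
    using assms unfolding is_lorentzian_def by blast
  from arg_cong[OF P(2), of det] have "(det P)\<^sup>2 * det M = -1"
    by (simp add: det_mul det_transpose det_lorentz_diag power2_eq_square mult_ac)
  then show ?thesis
    by (smt (verit) mult_nonneg_nonneg zero_le_power2)
qed

lemma transpose_matrix_inv: "transpose (matrix_inv M) = matrix_inv (transpose M)" if "invertible M" for M :: "real^'n^'n"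
proof -
  have "transpose (matrix_inv M) ** transpose M = mat 1"
    by (metis matrix_inv_right matrix_transpose_mul that transpose_mat)
  moreover have "transpose M ** matrix_inv (transpose M) = mat 1"
    by (intro matrix_inv_right transpose_invertible that)
  ultimately show ?thesis by (metis matrix_mul_assoc matrix_mul_lid matrix_mul_rid)
qed

lemma matrix_scaleR_left: "(c *\<^sub>R A) ** B = c *\<^sub>R (A ** B)" for A :: "real^'n^'m"
  by (simp add: vec_eq_iff matrix_matrix_mult_def sum_distrib_left mult_ac)

lemma matrix_scaleR_right: "A ** (c *\<^sub>R B) = c *\<^sub>R (A ** B)" for A :: "real^'n^'m"
  by (simp add: vec_eq_iff matrix_matrix_mult_def sum_distrib_left mult_ac)

lemma matrix_minus_left: "(- A) ** B = - (A ** B)" for A :: "real^'n^'m"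
  by (simp add: vec_eq_iff matrix_matrix_mult_def sum_negf)

lemma matrix_minus_right: "A ** (- B) = - (A ** B)" for A :: "real^'n^'m"
  by (simp add: vec_eq_iff matrix_matrix_mult_def sum_negf)

lemma matrix_diff_left: "(A - B) ** C = A ** C - B ** C" for A :: "real^'n^'m"
  by (simp add: vec_eq_iff matrix_matrix_mult_def sum_subtractf algebra_simps)

lemma dual2_scaleR: "dual2 (c *\<^sub>R X) = c *\<^sub>R dual2 X"
  by (simp add: vec_eq_iff dual2_def sum_distrib_left mult_ac)

lemma sum_dual2_dual2:
  assumes X: "\<forall>a b. X $ a $ b = - X $ b $ a" and Y: "\<forall>a b. Y $ a $ b = - Y $ b $ a"
  shows "(\<Sum>a\<in>UNIV. \<Sum>b\<in>UNIV. dual2 X $ a $ b * dual2 Y $ a $ b) = (\<Sum>a\<in>UNIV. \<Sum>b\<in>UNIV. X $ a $ b * Y $ a $ b)"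
  by (simp add: sum_4 dual2_skew_4[OF X] dual2_skew_4[OF Y] skew_4[OF X] skew_4[OF Y])

context
  fixes M N :: "real^4^4"
  assumes M: "is_lorentzian M" and N: "N = matrix_inv M"
begin

text \<open>The value -1 in the last claim is where the Lorentzian signature enters; every sign in
  the duality identities below goes back to it.\<close>

lemma lorentzian_inverse:
  shows "N ** M = mat 1" "M ** N = mat 1" "transpose N = N" "\<bar>det M\<bar> * det N = -1"
proof -
  have det: "det M < 0" using M by (rule is_lorentzian_det_neg)
  then have inv: "invertible M" by (simp add: invertible_det_nz)
  show NM: "N ** M = mat 1" "M ** N = mat 1" using inv by (simp_all add: N matrix_inv)
  show "transpose N = N" using M inv by (simp add: N transpose_matrix_inv is_lorentzian_def)
  have "det M * det N = 1" using arg_cong[OF NM(2), of det] by (simp add: det_mul)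
  with det show "\<bar>det M\<bar> * det N = -1" by simp
qed

lemma raise_skew: "\<forall>a b. (N ** F ** N) $ a $ b = - (N ** F ** N) $ b $ a"
  if "\<forall>a b. F $ a $ b = - F $ b $ a"
  using that unfolding skew_transpose
  by (simp add: matrix_transpose_mul lorentzian_inverse(3) matrix_mul_assoc matrix_minus_left matrix_minus_right)

lemma hodge_skew: "\<forall>a b. hodge M F $ a $ b = - hodge M F $ b $ a"
  if "\<forall>a b. F $ a $ b = - F $ b $ a" for F :: "real^4^4"
proof (intro allI)
  fix a b
  show "hodge M F $ a $ b = - hodge M F $ b $ a"
    using dual2_skew[OF raise_skew[OF that], of a b]
    by (simp add: hodge_dual2 N[symmetric] lorentzian_inverse(3))
qed

text \<open>Raising both indices of the dual undoes the raising inside it, by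
  \<open>dual2_congruence\<close> with the symmetric \<open>N\<close>.\<close>

lemma raise_hodge: "N ** hodge M F ** N = (sqrt \<bar>det M\<bar> * det N) *\<^sub>R dual2 F"
  using dual2_congruence[of N F]
  by (simp add: hodge_dual2 N[symmetric] lorentzian_inverse(3) matrix_scaleR_left matrix_scaleR_right)

text \<open>Two square roots and \<open>det N\<close> multiply to the signature sign, while
  \<open>dual2\<close> is an involution.\<close>

lemma hodge_hodge: "hodge M (hodge M F) = - F"
  if "\<forall>a b. F $ a $ b = - F $ b $ a" for F :: "real^4^4"
proof -
  have "hodge M (hodge M F) = (sqrt \<bar>det M\<bar> * (sqrt \<bar>det M\<bar> * det N)) *\<^sub>R F"
    by (subst hodge_dual2) (simp add: N[symmetric] lorentzian_inverse(3) raise_hodge dual2_scaleR dual2_dual2[OF that])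
  also have "sqrt \<bar>det M\<bar> * (sqrt \<bar>det M\<bar> * det N) = \<bar>det M\<bar> * det N"
    by (simp flip: mult.assoc)
  finally show ?thesis using lorentzian_inverse(4) by simp
qed

lemma twoform_dot_commute: "twoform_dot N H F = twoform_dot N F H"
proof -
  have sym: "N $ i $ j = N $ j $ i" for i j
    using arg_cong[OF lorentzian_inverse(3), of "\<lambda>A. A $ j $ i"] by (simp add: transpose_def)
  show ?thesis
    unfolding twoform_dot_def by (rule trans[OF sum_swap22]) (simp add: sym mult_ac)
qed

text \<open>One factor is kept lowered and the other is raised, so that both become values of
  \<open>dual2\<close>, which preserves the entrywise pairing. The prefactors again multiply to
  -1.\<close>

lemma twoform_dot_hodge_hodge: "twoform_dot N (hodge M F) (hodge M H) = - twoform_dot N F H"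
  if F: "\<forall>a b. F $ a $ b = - F $ b $ a" and H: "\<forall>a b. H $ a $ b = - H $ b $ a"
proof -
  have "twoform_dot N (hodge M F) (hodge M H) =
     (\<Sum>a\<in>UNIV. \<Sum>b\<in>UNIV. (sqrt \<bar>det M\<bar> * dual2 (N ** F ** N) $ a $ b) * ((sqrt \<bar>det M\<bar> * det N) * dual2 H $ a $ b))"
    unfolding twoform_dot_matrix lorentzian_inverse(3) raise_hodge
    by (simp add: hodge_dual2 N[symmetric] lorentzian_inverse(3))
  also have "\<dots> = (\<bar>det M\<bar> * det N) * (\<Sum>a\<in>UNIV. \<Sum>b\<in>UNIV. dual2 (N ** F ** N) $ a $ b * dual2 H $ a $ b)"
  proof -
    have "(sqrt \<bar>det M\<bar> * x) * ((sqrt \<bar>det M\<bar> * det N) * y) = (\<bar>det M\<bar> * det N) * (x * y)" for x y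
      using real_sqrt_mult_self[of "\<bar>det M\<bar>"] by (simp add: algebra_simps)
    then show ?thesis by (simp only: sum_distrib_left)
  qed
  also have "\<dots> = - (\<Sum>a\<in>UNIV. \<Sum>b\<in>UNIV. (N ** F ** N) $ a $ b * H $ a $ b)"
    by (simp add: lorentzian_inverse(4) sum_dual2_dual2[OF raise_skew[OF F] H])
  also have "(\<Sum>a\<in>UNIV. \<Sum>b\<in>UNIV. (N ** F ** N) $ a $ b * H $ a $ b) = twoform_dot N H F"
    by (simp add: twoform_dot_matrix lorentzian_inverse(3) mult.commute)
  also have "twoform_dot N H F = twoform_dot N F H" by (rule twoform_dot_commute)
  finally show ?thesis .
qed

text \<open>Self-adjointness of the star: put \<open>hodge M H\<close> for \<open>H\<close> in
  \<open>twoform_dot_hodge_hodge\<close> and use that the star squares to -1.\<close>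

lemma twoform_dot_hodge_left: "twoform_dot N (hodge M F) H = twoform_dot N F (hodge M H)"
  if F: "\<forall>a b. F $ a $ b = - F $ b $ a" and H: "\<forall>a b. H $ a $ b = - H $ b $ a"
  using twoform_dot_hodge_hodge[OF F hodge_skew[OF H]] hodge_hodge[OF H]
  by (simp add: twoform_dot_def sum_negf)

lemma hodge_contract:
  assumes F: "\<forall>a b. F $ a $ b = - F $ b $ a" and H: "\<forall>a b. H $ a $ b = - H $ b $ a"
  shows "(\<Sum>c\<in>UNIV. \<Sum>d\<in>UNIV. N $ c $ d * (hodge M F $ a $ c * hodge M H $ b $ d)) =
    (\<Sum>c\<in>UNIV. \<Sum>d\<in>UNIV. N $ c $ d * (H $ a $ c * F $ b $ d)) - (1/2) * M $ a $ b * twoform_dot N F H"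
proof -
  let ?s = "sqrt \<bar>det M\<bar>"
  \<comment> \<open>Antisymmetry of \<open>Y\<close> brings the summed index to the inside, at the
    cost of a sign, and makes the contraction a matrix product.\<close>
  have prod: "(\<Sum>c\<in>UNIV. \<Sum>d\<in>UNIV. N $ c $ d * (X $ a $ c * Y $ b $ d)) = - (X ** N ** Y) $ a $ b"
    if "\<forall>a b. Y $ a $ b = - Y $ b $ a" for X Y :: "real^4^4"
  proof -
    have "(\<Sum>c\<in>UNIV. \<Sum>d\<in>UNIV. N $ c $ d * (X $ a $ c * Y $ b $ d)) = (\<Sum>d\<in>UNIV. \<Sum>c\<in>UNIV. - (X $ a $ c * N $ c $ d * Y $ d $ b))"
      by (subst sum.swap) (simp add: that[rule_format, of b] mult_ac)
    then show ?thesis by (simp add: matrix_matrix_mult_def sum_distrib_right sum_negf)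
  qed
  \<comment> \<open>Cancelling one \<open>N\<close> of \<open>raise_hodge\<close> against
    \<open>M\<close> lets the metric between the two stars disappear, so that two values of
    \<open>dual2\<close> become adjacent and \<open>dual2_mult_dual2\<close> applies.\<close>
  have "N ** hodge M H = (?s * det N) *\<^sub>R (dual2 H ** M)"
    using arg_cong[OF raise_hodge[of H], of "\<lambda>A. A ** M"] lorentzian_inverse(1)
    by (simp add: matrix_mul_assoc[symmetric] matrix_scaleR_left)
  then have "hodge M F ** N ** hodge M H = (?s * (?s * det N)) *\<^sub>R (dual2 (N ** F ** N) ** dual2 H ** M)"
    by (simp add: matrix_mul_assoc[symmetric] hodge_dual2[of M F] N[symmetric] lorentzian_inverse(3)
        matrix_scaleR_left matrix_scaleR_right)
  also have "?s * (?s * det N) = -1"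
    using lorentzian_inverse(4) by (simp flip: mult.assoc)
  also have "dual2 (N ** F ** N) ** dual2 H = - (H ** (N ** F ** N))
      - ((1/2) * twoform_dot N H F) *\<^sub>R mat 1"
    by (simp add: dual2_mult_dual2[OF raise_skew[OF F] H] twoform_dot_matrix lorentzian_inverse(3) mult.commute)
  finally have "hodge M F ** N ** hodge M H = H ** N ** F + ((1/2) * twoform_dot N H F) *\<^sub>R M"
    using lorentzian_inverse(1)
    by (simp add: matrix_diff_left matrix_minus_left matrix_scaleR_left matrix_mul_assoc[symmetric])
  then show ?thesis
    unfolding prod[OF F] prod[OF hodge_skew[OF H]] by (simp add: twoform_dot_commute algebra_simps)
qed

end

subsection \<open>Partial derivatives\<close>

text \<open>No differentiability is assumed: both functions have the same derivatives in the
  relational sense, so the choice operator picks the same value even if there is none.\<close>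

lemma frechet_derivative_cong_open:
  assumes "open S" "x \<in> S" "\<And>y. y \<in> S \<Longrightarrow> f y = g y"
  shows "frechet_derivative f (at x) = frechet_derivative g (at x)"
proof -
  have "(f has_derivative D) (at x) \<longleftrightarrow> (g has_derivative D) (at x)" for D
    using has_derivative_transform_within_open[of f D x UNIV S g]
      has_derivative_transform_within_open[of g D x UNIV S f] assms by auto
  then show ?thesis by (simp add: frechet_derivative_def)
qed

lemma pd_cong_open:
  "open S \<Longrightarrow> x \<in> S \<Longrightarrow> (\<And>y. y \<in> S \<Longrightarrow> f y = g y) \<Longrightarrow> pd f k x = pd g k x"
  unfolding pd_def by (subst frechet_derivative_cong_open) auto

lemma pd_eqI: "(f has_derivative D) (at x) \<Longrightarrow> pd f k x = D (axis k 1)"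
  by (simp add: pd_def frechet_derivative_eqI)

lemma differentiable_has_derivative:
  "f differentiable at x \<Longrightarrow> (f has_derivative frechet_derivative f (at x)) (at x)"
  by (simp add: frechet_derivative_works)

lemma pd_bounded_linear:
  "bounded_linear L \<Longrightarrow> f differentiable at x \<Longrightarrow> pd (\<lambda>y. L (f y)) k x = L (pd f k x)"
  by (rule trans[OF pd_eqI[OF bounded_linear.has_derivative[OF _ differentiable_has_derivative]]])
    (auto simp: pd_def)

lemma pd_nth: "f differentiable at x \<Longrightarrow> pd (\<lambda>y. f y $ i) k x = pd f k x $ i"
  by (rule pd_bounded_linear[OF bounded_linear_vec_nth])

lemma pd_bounded_bilinear:
  "bounded_bilinear B \<Longrightarrow> f differentiable at x \<Longrightarrow> g differentiable at x \<Longrightarrow>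
    pd (\<lambda>y. B (f y) (g y)) k x = B (f x) (pd g k x) + B (pd f k x) (g x)"
  by (rule trans[OF pd_eqI[OF bounded_bilinear.FDERIV[OF _ differentiable_has_derivative differentiable_has_derivative]]])
    (auto simp: pd_def)

lemma pd_add: "f differentiable at x \<Longrightarrow> g differentiable at x \<Longrightarrow> pd (\<lambda>y. f y + g y) k x = pd f k x + pd g k x"
  by (rule trans[OF pd_eqI[OF has_derivative_add[OF differentiable_has_derivative differentiable_has_derivative]]])
    (auto simp: pd_def)

lemma pd_minus: "f differentiable at x \<Longrightarrow> pd (\<lambda>y. - f y) k x = - pd f k x"
  by (rule pd_bounded_linear[OF bounded_linear_minus[OF bounded_linear_ident]])

lemma pd_const: "pd (\<lambda>y. c) k x = 0"
  by (simp add: pd_def)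

lemma pd_sum: "(\<And>i. i \<in> I \<Longrightarrow> f i differentiable at x) \<Longrightarrow> pd (\<lambda>y. \<Sum>i\<in>I. f i y) k x = (\<Sum>i\<in>I. pd (f i) k x)"
  by (rule trans[OF pd_eqI[OF has_derivative_sum[OF differentiable_has_derivative]]])
    (auto simp: pd_def)

lemma linear_axis_expand: "linear L \<Longrightarrow> L v = (\<Sum>m\<in>UNIV. v $ m *\<^sub>R L (axis m 1))" for v :: "real^'n"
proof -
  assume L: "linear L"
  have "v = (\<Sum>m\<in>UNIV. v $ m *\<^sub>R axis m 1)"
    by (simp add: vec_eq_iff axis_def if_distrib cong: if_cong)
  then have "L v = L (\<Sum>m\<in>UNIV. v $ m *\<^sub>R axis m 1)" by (rule arg_cong)
  then show ?thesis by (simp only: linear_sum[OF L] linear_scale[OF L])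
qed

lemma pd_compose:
  fixes \<phi> :: "real^'m \<Rightarrow> real^'n"
  assumes f: "f differentiable at (\<phi> x)" and \<phi>: "\<phi> differentiable at x"
  shows "pd (\<lambda>y. f (\<phi> y)) a x = (\<Sum>m\<in>UNIV. pd \<phi> a x $ m *\<^sub>R pd f m (\<phi> x))"
proof -
  have "pd (\<lambda>y. f (\<phi> y)) a x = frechet_derivative f (at (\<phi> x)) (pd \<phi> a x)"
    by (rule trans[OF pd_eqI[OF has_derivative_compose[OF
        differentiable_has_derivative[OF \<phi>] differentiable_has_derivative[OF f]]]]) (simp add: pd_def)
  also have "\<dots> = (\<Sum>m\<in>UNIV. pd \<phi> a x $ m *\<^sub>R frechet_derivative f (at (\<phi> x)) (axis m 1))"
    by (rule linear_axis_expand[OF linear_frechet_derivative[OF f]])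
  finally show ?thesis by (simp add: pd_def)
qed

lemma differentiable_nth: "f differentiable F \<Longrightarrow> (\<lambda>y. f y $ i) differentiable F"
  unfolding differentiable_def using bounded_linear.has_derivative[OF bounded_linear_vec_nth] by blast

lemma differentiable_bounded_linear: "bounded_linear L \<Longrightarrow> f differentiable F \<Longrightarrow> (\<lambda>y. L (f y)) differentiable F"
  unfolding differentiable_def using bounded_linear.has_derivative by blast

lemma differentiable_vec:
  fixes f :: "'a::real_normed_vector \<Rightarrow> 'b::euclidean_space^'n"
  assumes "\<And>i. (\<lambda>y. f y $ i) differentiable F"
  shows "f differentiable F"
proof -
  have "linear (axis i :: 'b \<Rightarrow> 'b^'n)" for i
    by (rule linearI) (auto simp: vec_eq_iff axis_def)
  then have bl: "bounded_linear (axis i :: 'b \<Rightarrow> 'b^'n)" for i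
    by (simp add: linear_conv_bounded_linear)
  have "(\<lambda>y. \<Sum>i\<in>UNIV. axis i (f y $ i)) differentiable F"
    by (rule differentiable_sum) (use differentiable_bounded_linear[OF bl assms] in auto)
  moreover have "(\<Sum>i\<in>UNIV. axis i (f y $ i)) = f y" for y
    by (simp add: vec_eq_iff axis_def)
  ultimately show ?thesis by simp
qed

lemma bounded_bilinear_matrix_mult: "bounded_bilinear ((**) :: real^'n^'m \<Rightarrow> real^'p^'n \<Rightarrow> real^'p^'m)"
  unfolding bilinear_conv_bounded_bilinear[symmetric] bilinear_def
  by (intro conjI allI linearI)
    (simp_all add: vec_eq_iff matrix_matrix_mult_def sum.distrib sum_distrib_left algebra_simps)

lemma bounded_bilinear_matrix_vector_mult: "bounded_bilinear ((*v) :: real^'n^'m \<Rightarrow> real^'n \<Rightarrow> real^'m)"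
  unfolding bilinear_conv_bounded_bilinear[symmetric] bilinear_def
  by (intro conjI allI linearI)
    (simp_all add: vec_eq_iff matrix_vector_mult_def sum.distrib sum_distrib_left algebra_simps)

lemma differentiable_bounded_bilinear:
  "bounded_bilinear B \<Longrightarrow> f differentiable at x \<Longrightarrow> g differentiable at x \<Longrightarrow> (\<lambda>y. B (f y) (g y)) differentiable at x"
  by (rule differentiableI[OF bounded_bilinear.FDERIV[OF _ differentiable_has_derivative differentiable_has_derivative]])

lemmas pd_matrix_mult = pd_bounded_bilinear[OF bounded_bilinear_matrix_mult]
lemmas pd_mult = pd_bounded_bilinear[OF bounded_bilinear_mult]
lemmas differentiable_matrix_mult = differentiable_bounded_bilinear[OF bounded_bilinear_matrix_mult]

subsection \<open>Taming matrices\<close>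

definition up :: "'a^('v::finite + 'v) \<Rightarrow> 'a^'v" where "up \<xi> = (\<chi> i. \<xi> $ Inl i)"
definition lo :: "'a^('v::finite + 'v) \<Rightarrow> 'a^'v" where "lo \<xi> = (\<chi> i. \<xi> $ Inr i)"
definition pair :: "'a^'v::finite \<Rightarrow> 'a^'v \<Rightarrow> 'a^('v + 'v)" where
  "pair x y = (\<chi> s. case s of Inl i \<Rightarrow> x $ i | Inr i \<Rightarrow> y $ i)"

definition UL :: "real^('v::finite + 'v)^('v + 'v) \<Rightarrow> real^'v^'v" where "UL M = (\<chi> i j. M $ Inl i $ Inl j)"
definition UR :: "real^('v::finite + 'v)^('v + 'v) \<Rightarrow> real^'v^'v" where "UR M = (\<chi> i j. M $ Inl i $ Inr j)"
definition LL :: "real^('v::finite + 'v)^('v + 'v) \<Rightarrow> real^'v^'v" where "LL M = (\<chi> i j. M $ Inr i $ Inl j)"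
definition LR :: "real^('v::finite + 'v)^('v + 'v) \<Rightarrow> real^'v^'v" where "LR M = (\<chi> i j. M $ Inr i $ Inr j)"

lemma up_lo_pair [simp]: "up (pair x y) = x" "lo (pair x y) = y"
  by (simp_all add: up_def lo_def pair_def)

lemma up_lo_minus [simp]: "up (- \<xi>) = - up \<xi>" "lo (- \<xi>) = - lo \<xi>" for \<xi> :: "'a::ab_group_add^('v::finite + 'v)"
  by (simp_all add: up_def lo_def vec_eq_iff)

lemma up_lo_0 [simp]: "up 0 = 0" "lo 0 = 0"
  by (simp_all add: up_def lo_def vec_eq_iff)

lemma sum_UNIV_Plus: "(\<Sum>s\<in>UNIV. h s) = (\<Sum>i\<in>UNIV. h (Inl i)) + (\<Sum>i\<in>UNIV. h (Inr i))"
  for h :: "('a::finite + 'b::finite) \<Rightarrow> 'c::comm_monoid_add"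
  using sum.Plus[of "UNIV :: 'a set" "UNIV :: 'b set" h] by (simp add: o_def)

lemma up_lo_matrix_vector_mult:
  fixes M :: "real^('v::finite + 'v)^('v + 'v)"
  shows "up (M *v \<xi>) = UL M *v up \<xi> + UR M *v lo \<xi>" "lo (M *v \<xi>) = LL M *v up \<xi> + LR M *v lo \<xi>"
  by (simp_all add: vec_eq_iff up_def lo_def UL_def UR_def LL_def LR_def matrix_vector_mult_def sum_UNIV_Plus)

lemma omega_up_lo: "omega \<xi> \<eta> = lo \<xi> \<bullet> up \<eta> - up \<xi> \<bullet> lo \<eta>"
  by (simp add: omega_def up_def lo_def inner_vec_def sum_subtractf)

lemma omega_minus: "omega (- \<xi>) \<eta> = - omega \<xi> \<eta>" "omega \<xi> (- \<eta>) = - omega \<xi> \<eta>"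
  by (simp_all add: omega_up_lo)

lemma omega_commute: "omega \<xi> \<eta> = - omega \<eta> \<xi>"
  by (simp add: omega_up_lo inner_commute)

lemma inner_matrix_transpose: "x \<bullet> (A *v y) = (transpose A *v x) \<bullet> y" for A :: "real^'n^'m"
  by (simp add: dot_lmul_matrix)

lemma transpose_eqI: "transpose A = B" if "\<And>x y. x \<bullet> (A *v y) = (B *v x) \<bullet> y" for A :: "real^'n^'m"
proof -
  have "(transpose A *v x - B *v x) \<bullet> y = 0" for x y
    using that[of x y] inner_matrix_transpose[of x A y] by (simp only: inner_diff_left)
  then have "transpose A *v x - B *v x = 0" for x
    by (rule iffD1[OF inner_eq_zero_iff])
  then show ?thesis by (simp add: matrix_eq)
qed

text \<open>The pointwise condition of \<open>taming_map\<close>, separated from smoothness so that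
  it can be used for a single matrix.\<close>

definition tame :: "real^('v::finite + 'v)^('v + 'v) \<Rightarrow> bool" where
  "tame M \<longleftrightarrow> M ** M = - mat 1 \<and> (\<forall>\<xi> \<eta>. omega (M *v \<xi>) (M *v \<eta>) = omega \<xi> \<eta>) \<and>
     (\<forall>\<xi>. \<xi> \<noteq> 0 \<longrightarrow> omega \<xi> (M *v \<xi>) > 0)"

lemma I_of_UR: "I_of M = matrix_inv (UR M)"
  by (simp add: I_of_def UR_def)

lemma R_of_UL: "R_of M = - (I_of M ** UL M)"
  by (simp add: R_of_def UL_def)

lemma matrix_vector_mult_minus_left: "(- A) *v x = - (A *v x)" for A :: "real^'n^'m"
  by (simp add: vec_eq_iff matrix_vector_mult_def sum_negf)

lemma matrix_vector_mult_minus_right: "A *v (- x) = - (A *v x)" for A :: "real^'n^'m"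
  by (simp add: vec_eq_iff matrix_vector_mult_def sum_negf)

lemma transpose_minus: "transpose (- A) = - transpose A" for A :: "real^'n^'m"
  by (simp add: vec_eq_iff transpose_def)

lemma matrix_diff_right: "A ** (B - C) = A ** B - A ** C" for A :: "real^'n^'m"
  by (simp add: vec_eq_iff matrix_matrix_mult_def sum_subtractf algebra_simps)

lemma tame_square: "tame M \<Longrightarrow> M *v (M *v \<xi>) = - \<xi>"
  by (simp add: tame_def matrix_vector_mul_assoc matrix_vector_mult_minus_left)

text \<open>Applying \<open>M\<close> to both arguments and using \<open>M ** M = - mat 1\<close>
  turns the alternating form into a symmetric one. Its values on coordinate subspaces give the
  symmetry of \<open>I_of\<close> and \<open>R_of\<close>.\<close>

lemma omega_tame_commute: "tame M \<Longrightarrow> omega \<xi> (M *v \<eta>) = omega \<eta> (M *v \<xi>)"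
proof -
  assume M: "tame M"
  then have "omega \<xi> (M *v \<eta>) = omega (M *v \<xi>) (M *v (M *v \<eta>))" by (simp add: tame_def)
  also have "\<dots> = omega \<eta> (M *v \<xi>)"
    by (simp only: tame_square[OF M] omega_minus omega_commute[of "M *v \<xi>" \<eta>] minus_minus)
  finally show ?thesis .
qed

context
  fixes M :: "real^('v::finite + 'v)^('v + 'v)"
  assumes M: "tame M"
begin

text \<open>On \<open>pair 0 x\<close> the positive form defined by \<open>M\<close> is
  \<open>x \<bullet> (UR M *v x)\<close>, so a kernel vector of the block would violate
  positivity.\<close>

lemma tame_invertible_UR: "invertible (UR M)"
proof -
  have "x = 0" if "UR M *v x = 0" for x
  proof (rule ccontr)
    assume "x \<noteq> 0"
    then have "pair 0 x \<noteq> 0" by (metis up_lo_0(2) up_lo_pair(2))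
    then have "omega (pair 0 x) (M *v pair 0 x) > 0" using M by (simp add: tame_def)
    then show False using that by (simp add: omega_up_lo up_lo_matrix_vector_mult)
  qed
  then show ?thesis by (metis invertible_left_inverse matrix_left_invertible_ker)
qed

lemma tame_I_of: "I_of M ** UR M = mat 1" "UR M ** I_of M = mat 1"
  using tame_invertible_UR by (simp_all add: I_of_UR matrix_inv)

lemma tame_symmetric_I_of: "transpose (I_of M) = I_of M"
proof -
  have "transpose (UR M) = UR M"
  proof (rule transpose_eqI)
    show "x \<bullet> (UR M *v y) = (UR M *v x) \<bullet> y" for x y
      using omega_tame_commute[OF M, of "pair 0 x" "pair 0 y"]
      by (simp add: omega_up_lo up_lo_matrix_vector_mult inner_commute)
  qed
  then show ?thesis by (simp add: I_of_UR transpose_matrix_inv[OF tame_invertible_UR])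
qed

text \<open>The upper right block of \<open>M ** M = - mat 1\<close>, multiplied by
  \<open>I_of M\<close> from the left.\<close>

lemma tame_LR: "LR M = R_of M ** UR M"
proof -
  have "UL M *v (UR M *v y) + UR M *v (LR M *v y) = 0" for y
    using arg_cong[OF tame_square[OF M, of "pair 0 y"], of up] by (simp add: up_lo_matrix_vector_mult)
  then have "UR M *v (LR M *v y) = - (UL M *v (UR M *v y))" for y
    by (metis add.commute add_eq_0_iff2)
  then have "UR M ** LR M = - (UL M ** UR M)"
    by (simp add: matrix_eq matrix_vector_mul_assoc[symmetric] matrix_vector_mult_minus_left)
  from arg_cong[OF this, of "(**) (I_of M)"] show ?thesis
    by (simp add: matrix_mul_assoc tame_I_of R_of_UL matrix_minus_left matrix_minus_right)
qed

text \<open>The same with the upper left block. Both identities are kept free of inverses so that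
  they can be differentiated by the product rule.\<close>

lemma tame_LL: "LL M = - I_of M + R_of M ** UL M"
proof -
  have "UL M *v (UL M *v y) + UR M *v (LL M *v y) = - y" for y
    using arg_cong[OF tame_square[OF M, of "pair y 0"], of up] by (simp add: up_lo_matrix_vector_mult)
  then have "UR M *v (LL M *v y) = - y - UL M *v (UL M *v y)" for y
    by (metis add_diff_cancel_left')
  then have "UR M ** LL M = - mat 1 - UL M ** UL M"
    by (simp add: matrix_eq matrix_vector_mul_assoc[symmetric] matrix_vector_mult_minus_left matrix_vector_mult_diff_rdistrib)
  from arg_cong[OF this, of "(**) (I_of M)"] show ?thesis
    by (simp add: matrix_mul_assoc tame_I_of R_of_UL matrix_minus_left matrix_minus_right matrix_diff_right)
qed

lemma tame_symmetric_R_of: "transpose (R_of M) = R_of M"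
proof -
  have "transpose (UL M) = - LR M"
  proof (rule transpose_eqI)
    show "x \<bullet> (UL M *v y) = (- LR M *v x) \<bullet> y" for x y
      using omega_tame_commute[OF M, of "pair 0 x" "pair y 0"]
      by (simp add: omega_up_lo up_lo_matrix_vector_mult inner_commute matrix_vector_mult_minus_left)
  qed
  then have "transpose (R_of M) = LR M ** I_of M"
    by (simp add: R_of_UL transpose_minus matrix_transpose_mul tame_symmetric_I_of matrix_minus_left)
  then show ?thesis
    by (simp add: tame_LR matrix_mul_assoc[symmetric] tame_I_of)
qed

text \<open>With \<open>\<xi> = (F, G)\<close> and \<open>-M \<xi> = (F', G')\<close>, where \<open>F'\<close> is the Hodge dual of \<open>F\<close> on the
  configuration space, these are \<open>G = R F - I F'\<close> and \<open>G' = R F' + I F\<close>.\<close>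

lemma tame_lo: "lo \<xi> = R_of M *v up \<xi> - I_of M *v up (- (M *v \<xi>))"
proof -
  have "I_of M *v up (M *v \<xi>) = - (R_of M *v up \<xi>) + lo \<xi>"
    by (simp add: up_lo_matrix_vector_mult matrix_vector_right_distrib matrix_vector_mul_assoc tame_I_of
        R_of_UL matrix_vector_mult_minus_left)
  then show ?thesis by (simp add: matrix_vector_mult_minus_right)
qed

lemma tame_lo_dual: "lo (- (M *v \<xi>)) = R_of M *v up (- (M *v \<xi>)) + I_of M *v up \<xi>"
  by (simp add: up_lo_matrix_vector_mult tame_LR tame_LL matrix_vector_mult_minus_right matrix_vector_right_distrib
      matrix_vector_mult_add_rdistrib matrix_vector_mul_assoc matrix_vector_mult_minus_left
      matrix_vector_mult_diff_distrib matrix_vector_mult_diff_rdistrib)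

text \<open>Inserting the two relations for the lower components, the terms in \<open>R_of M\<close>
  cancel by its symmetry; field strengths and their duals are left, weighted by the same
  matrix.\<close>

lemma omega_tame:
  "omega \<xi> (M *v \<eta>) = up (- (M *v \<xi>)) \<bullet> (I_of M *v up (- (M *v \<eta>))) + up \<xi> \<bullet> (I_of M *v up \<eta>)"
proof -
  have "omega \<xi> (M *v \<eta>) = - omega \<xi> (- (M *v \<eta>))" by (simp add: omega_minus)
  also have "\<dots> = - (lo \<xi> \<bullet> up (- (M *v \<eta>))) + up \<xi> \<bullet> lo (- (M *v \<eta>))"
    by (simp add: omega_up_lo)
  also have "\<dots> = up (- (M *v \<xi>)) \<bullet> (I_of M *v up (- (M *v \<eta>))) + up \<xi> \<bullet> (I_of M *v up \<eta>)"
    unfolding tame_lo[of \<xi>] tame_lo_dual[of \<eta>] inner_matrix_transpose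
    by (simp add: inner_diff_left inner_add_right inner_matrix_transpose tame_symmetric_I_of tame_symmetric_R_of)
  finally show ?thesis .
qed

text \<open>The four hypotheses are the derivatives of the block identities, so \<open>dM\<close>,
  \<open>dI\<close> and \<open>dR\<close> may be the derivatives along any common direction.\<close>

lemma omega_deriv_tame:
  assumes "dI ** UR M + I_of M ** UR dM = 0"
    and "dR = - (dI ** UL M + I_of M ** UL dM)"
    and "LR dM = dR ** UR M + R_of M ** UR dM"
    and "LL dM = - dI + (dR ** UL M + R_of M ** UL dM)"
  shows "omega \<xi> (dM *v \<eta>) =
      up (- (M *v \<xi>)) \<bullet> (dR *v up \<eta>) - up (- (M *v \<xi>)) \<bullet> (dI *v up (- (M *v \<eta>)))
      + up \<xi> \<bullet> (dI *v up \<eta>) + up \<xi> \<bullet> (dR *v up (- (M *v \<eta>)))"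
proof -
  let ?S = "up (- (M *v \<eta>))"
  let ?u = "up (dM *v \<eta>)"
  have "I_of M ** UR dM = - (dI ** UR M)" using assms(1) by (simp add: add_eq_0_iff)
  moreover have "I_of M ** UL dM = - dR - dI ** UL M" using assms(2) by simp
  \<comment> \<open>Once the \<open>R_of M\<close> terms have cancelled, \<open>?u\<close> survives
    only multiplied by \<open>I_of M\<close>, so this product is computed and \<open>?u\<close>
    itself is not.\<close>
  ultimately have u: "I_of M *v ?u = dI *v ?S - dR *v up \<eta>"
    by (simp add: up_lo_matrix_vector_mult matrix_vector_right_distrib matrix_vector_mul_assoc matrix_vector_mult_minus_left
        matrix_vector_mult_minus_right matrix_vector_mult_diff_distrib matrix_vector_mult_diff_rdistrib)
  have l: "lo (dM *v \<eta>) = - (dI *v up \<eta>) - dR *v ?S + R_of M *v ?u"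
    by (simp add: up_lo_matrix_vector_mult assms(3,4) matrix_vector_right_distrib matrix_vector_mul_assoc
        matrix_vector_mult_minus_left matrix_vector_mult_minus_right matrix_vector_mult_add_rdistrib matrix_vector_mult_diff_distrib matrix_vector_mult_diff_rdistrib)
  have "omega \<xi> (dM *v \<eta>) = (R_of M *v up \<xi> - I_of M *v up (- (M *v \<xi>))) \<bullet> ?u
      - up \<xi> \<bullet> (- (dI *v up \<eta>) - dR *v ?S + R_of M *v ?u)"
    by (simp only: omega_up_lo l tame_lo[of \<xi>])
  also have "\<dots> = - (up (- (M *v \<xi>)) \<bullet> (I_of M *v ?u)) + up \<xi> \<bullet> (dI *v up \<eta>) + up \<xi> \<bullet> (dR *v ?S)"
    unfolding inner_diff_left inner_diff_right inner_add_right inner_minus_right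
      inner_matrix_transpose[of _ "I_of M"] inner_matrix_transpose[of _ "R_of M"] tame_symmetric_I_of tame_symmetric_R_of
    by simp
  finally show ?thesis unfolding u inner_diff_right by simp
qed

end

lemma bounded_linear_blocks:
  "bounded_linear (UL :: real^('v::finite + 'v)^('v + 'v) \<Rightarrow> _)" "bounded_linear (UR :: real^('v::finite + 'v)^('v + 'v) \<Rightarrow> _)"
  "bounded_linear (LL :: real^('v::finite + 'v)^('v + 'v) \<Rightarrow> _)" "bounded_linear (LR :: real^('v::finite + 'v)^('v + 'v) \<Rightarrow> _)"
  unfolding linear_conv_bounded_linear[symmetric]
  by (auto intro!: linearI simp: vec_eq_iff UL_def UR_def LL_def LR_def)

text \<open>The block identities hold on the open set \<open>V\<close> and may be differentiated at
  \<open>p\<close>; this replaces an explicit formula for the derivative of the inverse in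
  \<open>I_of\<close>.\<close>

lemma pd_tame:
  fixes J :: "real^'s::finite \<Rightarrow> real^('v::finite + 'v)^('v + 'v)" and k :: 's
  assumes V: "open V" "p \<in> V" and ball: "\<forall>q\<in>V. tame (J q)" and J: "J differentiable at p"
  defines "dM \<equiv> pd J k p" and "dI \<equiv> pd (\<lambda>q. I_of (J q)) k p" and "dR \<equiv> pd (\<lambda>q. R_of (J q)) k p"
  shows "(\<lambda>q. I_of (J q)) differentiable at p" "(\<lambda>q. R_of (J q)) differentiable at p"
    and "dI ** UR (J p) + I_of (J p) ** UR dM = 0"
    and "dR = - (dI ** UL (J p) + I_of (J p) ** UL dM)"
    and "LR dM = dR ** UR (J p) + R_of (J p) ** UR dM"
    and "LL dM = - dI + (dR ** UL (J p) + R_of (J p) ** UL dM)"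
proof -
  note tame = bspec[OF ball]
  note bl = bounded_linear_blocks[where 'v = 'v]
  note diff = differentiable_bounded_linear[OF _ J]
  have "det (UR (J p)) \<noteq> 0"
    using tame_invertible_UR[OF tame[OF V(2)]] by (simp add: invertible_det_nz)
  then have "(\<lambda>q. matrix_inv (UR (J q)) $ i $ j) differentiable at p" for i j
    by (intro differentiable_matrix_inv differentiable_nth diff bl)
  then show I: "(\<lambda>q. I_of (J q)) differentiable at p"
    unfolding I_of_UR by (intro differentiable_vec)
  show R: "(\<lambda>q. R_of (J q)) differentiable at p"
    unfolding R_of_UL by (intro differentiable_minus differentiable_matrix_mult I diff bl)
  have pd_eq: "pd f k p = pd h k p" if "\<And>q. q \<in> V \<Longrightarrow> f q = h q" for f h :: "real^'s::finite \<Rightarrow> real^'v^'v"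
    using V that by (rule pd_cong_open)
  have "pd (\<lambda>q. I_of (J q) ** UR (J q)) k p = pd (\<lambda>q. mat 1) k p"
    by (rule pd_eq) (rule tame_I_of[OF tame])
  then show "dI ** UR (J p) + I_of (J p) ** UR dM = 0"
    by (simp add: pd_matrix_mult I diff bl pd_bounded_linear[OF _ J] pd_const dI_def dM_def add.commute)
  show "dR = - (dI ** UL (J p) + I_of (J p) ** UL dM)"
    unfolding dR_def R_of_UL
    by (simp add: pd_minus differentiable_matrix_mult pd_matrix_mult I diff bl pd_bounded_linear[OF _ J] dI_def dM_def add.commute)
  have "pd (\<lambda>q. LR (J q)) k p = pd (\<lambda>q. R_of (J q) ** UR (J q)) k p"
    by (rule pd_eq) (rule tame_LR[OF tame])
  then show "LR dM = dR ** UR (J p) + R_of (J p) ** UR dM"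
    by (simp add: pd_matrix_mult R diff bl pd_bounded_linear[OF _ J] dR_def dM_def add.commute)
  have "pd (\<lambda>q. LL (J q)) k p = pd (\<lambda>q. - I_of (J q) + R_of (J q) ** UL (J q)) k p"
    by (rule pd_eq) (rule tame_LL[OF tame])
  also have "\<dots> = - dI + (R_of (J p) ** UL dM + dR ** UL (J p))"
    by (subst pd_add)
      (simp_all add: pd_minus differentiable_matrix_mult pd_matrix_mult I R diff bl pd_bounded_linear[OF _ J]
        dR_def dI_def dM_def)
  finally show "LL dM = - dI + (dR ** UL (J p) + R_of (J p) ** UL dM)"
    by (simp add: bl pd_bounded_linear[OF _ J] dM_def add.commute)
qed

section \<open>Electromagnetic contractions at a point\<close>

definition slot :: "'a^'n::finite^4^4 \<Rightarrow> 'n \<Rightarrow> 'a^4^4" where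
  "slot w s = (\<chi> a b. w $ a $ b $ s)"

lemma hodge_slot: "hodge m w $ a $ b $ s = hodge m (slot w s) $ a $ b" for w :: "real^'n::finite^4^4"
  by (simp add: hodge_def slot_def)

lemma sum_inner_matrix: "x \<bullet> (D *v y) = (\<Sum>L\<in>UNIV. \<Sum>S\<in>UNIV. D $ L $ S * (x $ L * y $ S))" for x :: "real^'n::finite"
  by (simp add: inner_vec_def matrix_vector_mult_def sum_distrib_left mult_ac)

lemma contract_inner_matrix:
  fixes X Y :: "real^'v::finite^4^4"
  shows "(\<Sum>c\<in>UNIV. \<Sum>d\<in>UNIV. N $ c $ d * (X $ a $ c \<bullet> (D *v Y $ b $ d))) =
    (\<Sum>L\<in>UNIV. \<Sum>S\<in>UNIV. D $ L $ S * (\<Sum>c\<in>UNIV. \<Sum>d\<in>UNIV. N $ c $ d * (slot X L $ a $ c * slot Y S $ b $ d)))"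
  unfolding sum_inner_matrix sum_distrib_left
  by (rule trans[OF sum_swap22]) (simp add: slot_def mult_ac)

lemma twoform_dot_inner_matrix:
  fixes X Y :: "real^'v::finite^4^4"
  shows "(\<Sum>a\<in>UNIV. \<Sum>b\<in>UNIV. \<Sum>c\<in>UNIV. \<Sum>d\<in>UNIV. N $ a $ c * N $ b $ d * (X $ a $ b \<bullet> (D *v Y $ c $ d))) =
    (\<Sum>L\<in>UNIV. \<Sum>S\<in>UNIV. D $ L $ S * twoform_dot N (slot X L) (slot Y S))"
proof -
  let ?f = "\<lambda>L S a b c d. D $ L $ S * (X $ a $ b $ L * N $ a $ c * N $ b $ d * Y $ c $ d $ S)"
  have "(\<Sum>a\<in>UNIV. \<Sum>b\<in>UNIV. \<Sum>c\<in>UNIV. \<Sum>d\<in>UNIV. N $ a $ c * N $ b $ d * (X $ a $ b \<bullet> (D *v Y $ c $ d)))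
    = (\<Sum>a\<in>UNIV. \<Sum>b\<in>UNIV. \<Sum>c\<in>UNIV. \<Sum>d\<in>UNIV. \<Sum>L\<in>UNIV. \<Sum>S\<in>UNIV. ?f L S a b c d)"
    unfolding sum_inner_matrix sum_distrib_left by (simp only: mult_ac)
  also have "\<dots> = (\<Sum>L\<in>UNIV. \<Sum>S\<in>UNIV. \<Sum>a\<in>UNIV. \<Sum>b\<in>UNIV. \<Sum>c\<in>UNIV. \<Sum>d\<in>UNIV. ?f L S a b c d)"
    by (rule sym[OF trans[OF sum.cong[OF refl sum_rotate4] sum_rotate4]])
  finally show ?thesis by (simp add: twoform_dot_def slot_def sum_distrib_left)
qed

context
  fixes m N :: "real^4^4" and j :: "real^('v::finite + 'v)^('v + 'v)" and w :: "real^('v + 'v)^4^4"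
    and F :: "'v \<Rightarrow> real^4^4"
  assumes m: "is_lorentzian m" and N: "N = matrix_inv m" and j: "tame j"
    and skew: "\<And>a b. w $ a $ b = - w $ b $ a"
    and hodge: "hodge m w = (\<chi> a b. - (j *v (w $ a $ b)))"
  defines "F \<equiv> \<lambda>L. slot w (Inl L)"
begin

lemma field_strength_skew: "\<forall>a b. F L $ a $ b = - F L $ b $ a"
proof (intro allI)
  show "F L $ a $ b = - F L $ b $ a" for a b
    using skew[of a b] by (simp add: F_def slot_def)
qed

lemma slot_up: "slot (\<chi> a b. up (w $ a $ b)) L = F L"
  by (simp add: F_def slot_def up_def)

lemma slot_up_hodge: "slot (\<chi> a b. up (- (j *v w $ a $ b))) L = hodge m (F L)"
proof -
  have "hodge m w $ a $ b = - (j *v w $ a $ b)" for a b by (simp add: hodge)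
  then have "slot (\<chi> a b. up (- (j *v w $ a $ b))) L = (\<chi> a b. hodge m w $ a $ b $ Inl L)"
    by (simp add: slot_def up_def)
  then show ?thesis by (simp add: hodge_slot F_def vec_eq_iff)
qed

text \<open>The pairing is an electric sum plus the same sum over Hodge duals. As
  \<open>I_of j\<close> is symmetric, \<open>hodge_contract\<close> turns the second into a copy of
  the first minus a trace, whence the factors 2 and 1/2.\<close>

lemma stress_omega:
  "(\<Sum>c\<in>UNIV. \<Sum>d\<in>UNIV. N $ c $ d * omega (w $ a $ c) (j *v w $ b $ d)) =
   2 * (\<Sum>L\<in>UNIV. \<Sum>S\<in>UNIV. \<Sum>c\<in>UNIV. \<Sum>d\<in>UNIV. I_of j $ L $ S * F L $ a $ c * N $ c $ d * F S $ b $ d)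
   - (1/2) * m $ a $ b * (\<Sum>L\<in>UNIV. \<Sum>S\<in>UNIV. \<Sum>c\<in>UNIV. \<Sum>d\<in>UNIV. \<Sum>e\<in>UNIV. \<Sum>h\<in>UNIV.
       I_of j $ L $ S * F L $ c $ d * N $ c $ e * N $ d $ h * F S $ e $ h)"
proof -
  let ?X = "\<chi> a b. up (w $ a $ b)" and ?Y = "\<chi> a b. up (- (j *v w $ a $ b))"
  let ?P = "\<lambda>L S. \<Sum>c\<in>UNIV. \<Sum>d\<in>UNIV. N $ c $ d * (F L $ a $ c * F S $ b $ d)"
  let ?A = "\<Sum>L\<in>UNIV. \<Sum>S\<in>UNIV. I_of j $ L $ S * ?P L S"
  have sym: "I_of j $ L $ S = I_of j $ S $ L" for L S
    using arg_cong[OF tame_symmetric_I_of[OF j], of "\<lambda>A. A $ S $ L"] by (simp add: transpose_def)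
  have "(\<Sum>c\<in>UNIV. \<Sum>d\<in>UNIV. N $ c $ d * omega (w $ a $ c) (j *v w $ b $ d)) =
     (\<Sum>c\<in>UNIV. \<Sum>d\<in>UNIV. N $ c $ d * (?Y $ a $ c \<bullet> (I_of j *v ?Y $ b $ d)))
     + (\<Sum>c\<in>UNIV. \<Sum>d\<in>UNIV. N $ c $ d * (?X $ a $ c \<bullet> (I_of j *v ?X $ b $ d)))"
    unfolding omega_tame[OF j] distrib_left sum.distrib by simp
  also have "\<dots> = (\<Sum>L\<in>UNIV. \<Sum>S\<in>UNIV. I_of j $ L $ S *
        (\<Sum>c\<in>UNIV. \<Sum>d\<in>UNIV. N $ c $ d * (hodge m (F L) $ a $ c * hodge m (F S) $ b $ d))) + ?A"
    unfolding contract_inner_matrix slot_up slot_up_hodge ..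
  also have "\<dots> = (\<Sum>L\<in>UNIV. \<Sum>S\<in>UNIV. I_of j $ L $ S * ?P S L)
      - (\<Sum>L\<in>UNIV. \<Sum>S\<in>UNIV. I_of j $ L $ S * ((1/2) * m $ a $ b * twoform_dot N (F L) (F S))) + ?A"
    unfolding hodge_contract[OF m N field_strength_skew field_strength_skew] right_diff_distrib sum_subtractf ..
  also have "(\<Sum>L\<in>UNIV. \<Sum>S\<in>UNIV. I_of j $ L $ S * ?P S L) = ?A"
    by (subst sum.swap) (simp only: sym)
  also have "?A = (\<Sum>L\<in>UNIV. \<Sum>S\<in>UNIV. \<Sum>c\<in>UNIV. \<Sum>d\<in>UNIV. I_of j $ L $ S * F L $ a $ c * N $ c $ d * F S $ b $ d)"
    by (simp only: sum_distrib_left mult_ac)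
  also have "(\<Sum>L\<in>UNIV. \<Sum>S\<in>UNIV. I_of j $ L $ S * ((1/2) * m $ a $ b * twoform_dot N (F L) (F S))) =
     (1/2) * m $ a $ b * (\<Sum>L\<in>UNIV. \<Sum>S\<in>UNIV. \<Sum>c\<in>UNIV. \<Sum>d\<in>UNIV. \<Sum>e\<in>UNIV. \<Sum>h\<in>UNIV.
       I_of j $ L $ S * F L $ c $ d * N $ c $ e * N $ d $ h * F S $ e $ h)"
    unfolding twoform_dot_def by (simp only: sum_distrib_left mult_ac)
  finally show ?thesis by simp
qed

text \<open>Of the four terms of \<open>omega_deriv_tame\<close>, the two with \<open>dR\<close>
  agree because the star is self-adjoint, and the two with \<open>dI\<close> because it reverses the
  sign of the pairing. A quarter of the doubled sums gives the halves of the scalar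
  equation.\<close>

lemma source_omega:
  assumes "dI ** UR j + I_of j ** UR dM = 0"
    and "dR = - (dI ** UL j + I_of j ** UL dM)"
    and "LR dM = dR ** UR j + R_of j ** UR dM"
    and "LL dM = - dI + (dR ** UL j + R_of j ** UL dM)"
  shows "(1/4) * (\<Sum>a\<in>UNIV. \<Sum>b\<in>UNIV. \<Sum>c\<in>UNIV. \<Sum>d\<in>UNIV. N $ a $ c * N $ b $ d * omega (w $ a $ b) (dM *v w $ c $ d)) =
    (1/2) * (\<Sum>L\<in>UNIV. \<Sum>S\<in>UNIV. \<Sum>a\<in>UNIV. \<Sum>b\<in>UNIV. \<Sum>c\<in>UNIV. \<Sum>d\<in>UNIV.
         dR $ L $ S * F L $ a $ b * N $ a $ c * N $ b $ d * hodge m (F S) $ c $ d)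
    + (1/2) * (\<Sum>L\<in>UNIV. \<Sum>S\<in>UNIV. \<Sum>a\<in>UNIV. \<Sum>b\<in>UNIV. \<Sum>c\<in>UNIV. \<Sum>d\<in>UNIV.
         dI $ L $ S * F L $ a $ b * N $ a $ c * N $ b $ d * F S $ c $ d)"
proof -
  let ?X = "\<chi> a b. up (w $ a $ b)" and ?Y = "\<chi> a b. up (- (j *v w $ a $ b))"
  let ?T = "\<lambda>D X Y. \<Sum>a\<in>UNIV. \<Sum>b\<in>UNIV. \<Sum>c\<in>UNIV. \<Sum>d\<in>UNIV. N $ a $ c * N $ b $ d * (X $ a $ b \<bullet> (D *v Y $ c $ d))"
  let ?R = "\<Sum>L\<in>UNIV. \<Sum>S\<in>UNIV. dR $ L $ S * twoform_dot N (F L) (hodge m (F S))"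
  let ?I = "\<Sum>L\<in>UNIV. \<Sum>S\<in>UNIV. dI $ L $ S * twoform_dot N (F L) (F S)"
  have "(\<Sum>a\<in>UNIV. \<Sum>b\<in>UNIV. \<Sum>c\<in>UNIV. \<Sum>d\<in>UNIV. N $ a $ c * N $ b $ d * omega (w $ a $ b) (dM *v w $ c $ d)) =
     ?T dR ?Y ?X - ?T dI ?Y ?Y + ?T dI ?X ?X + ?T dR ?X ?Y"
    unfolding omega_deriv_tame[OF j assms] distrib_left right_diff_distrib sum.distrib sum_subtractf by simp
  also have "?T dR ?Y ?X = ?R"
    unfolding twoform_dot_inner_matrix slot_up slot_up_hodge twoform_dot_hodge_left[OF m N field_strength_skew field_strength_skew] ..
  also have "?T dI ?Y ?Y = - ?I"
    unfolding twoform_dot_inner_matrix slot_up slot_up_hodge twoform_dot_hodge_hodge[OF m N field_strength_skew field_strength_skew]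
      mult_minus_right sum_negf ..
  also have "?T dI ?X ?X = ?I"
    unfolding twoform_dot_inner_matrix slot_up ..
  also have "?T dR ?X ?Y = ?R"
    unfolding twoform_dot_inner_matrix slot_up slot_up_hodge ..
  also have "?R - - ?I + ?I + ?R = 2 * ?R + 2 * ?I" by simp
  also have "?R = (\<Sum>L\<in>UNIV. \<Sum>S\<in>UNIV. \<Sum>a\<in>UNIV. \<Sum>b\<in>UNIV. \<Sum>c\<in>UNIV. \<Sum>d\<in>UNIV.
         dR $ L $ S * F L $ a $ b * N $ a $ c * N $ b $ d * hodge m (F S) $ c $ d)"
    by (simp only: twoform_dot_def sum_distrib_left mult.assoc)
  also have "?I = (\<Sum>L\<in>UNIV. \<Sum>S\<in>UNIV. \<Sum>a\<in>UNIV. \<Sum>b\<in>UNIV. \<Sum>c\<in>UNIV. \<Sum>d\<in>UNIV.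
         dI $ L $ S * F L $ a $ b * N $ a $ c * N $ b $ d * F S $ c $ d)"
    by (simp only: twoform_dot_def sum_distrib_left mult.assoc)
  finally show ?thesis by simp
qed

end

subsection \<open>The field equations in duality-covariant form\<close>

lemma Conf_iff:
  "(g, \<phi>, \<V>) \<in> Conf U V G J \<longleftrightarrow>
     g \<in> Lor U \<and> \<phi> \<in> extensional U \<and> smooth_on U \<phi> \<and> \<phi> ` U \<subseteq> V \<and>
     \<V> \<in> extensional U \<and> smooth_on U \<V> \<and> (\<forall>x\<in>U. \<forall>a b. \<V> x $ a $ b = - \<V> x $ b $ a) \<and>
     (\<forall>x\<in>U. hodge (g x) (\<V> x) = (\<chi> a b. - (J (\<phi> x) *v (\<V> x $ a $ b))))"
  by (simp add: Conf_def)

lemma Ffld_slot: "Ffld \<V> x = (\<lambda>L. slot (\<V> x) (Inl L))"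
  by (simp add: Ffld_def slot_def fun_eq_iff)

text \<open>The current whose covariant divergence is the left side of the scalar equation. The
  transpose is there because that equation contracts the first index of \<open>G\<close>.\<close>

definition flux :: "(real^4 \<Rightarrow> real^4^4) \<Rightarrow> (real^'s::finite \<Rightarrow> real^'s^'s) \<Rightarrow> (real^4 \<Rightarrow> real^'s) \<Rightarrow> real^4 \<Rightarrow> 4 \<Rightarrow> real^'s" where
  "flux g G \<phi> y a = (\<Sum>b\<in>UNIV. matrix_inv (g y) $ a $ b *\<^sub>R (transpose (G (\<phi> y)) *v pd \<phi> b y))"

text \<open>Left side minus right side, collected over \<open>k\<close> into a covector on the
  target. It transforms linearly as a whole, although its divergence and kinetic parts separately do
  not.\<close>

definition scalar_defect :: "(real^'s::finite \<Rightarrow> real^'s^'s) \<Rightarrow> (real^'s \<Rightarrow> real^('v::finite + 'v)^('v + 'v))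
    \<Rightarrow> ('s, 'v) field \<Rightarrow> real^4 \<Rightarrow> real^'s" where
  "scalar_defect G J c x = (case c of (g, \<phi>, \<V>) \<Rightarrow> \<chi> k.
     (\<Sum>a\<in>UNIV. pd (\<lambda>y. flux g G \<phi> y a $ k) a x) + (\<Sum>a\<in>UNIV. \<Sum>b\<in>UNIV. christ g x a a b * flux g G \<phi> x b $ k)
     - (1/2) * (\<Sum>c\<in>UNIV. \<Sum>d\<in>UNIV. matrix_inv (g x) $ c $ d * (pd \<phi> c x \<bullet> (pd G k (\<phi> x) *v pd \<phi> d x)))
     - (1/4) * (\<Sum>a\<in>UNIV. \<Sum>b\<in>UNIV. \<Sum>c\<in>UNIV. \<Sum>d\<in>UNIV. matrix_inv (g x) $ a $ c * matrix_inv (g x) $ b $ d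
          * omega (\<V> x $ a $ b) (pd J k (\<phi> x) *v \<V> x $ c $ d)))"

lemma einstein_eq_omega:
  fixes J :: "real^'s::finite \<Rightarrow> real^('v::finite + 'v)^('v + 'v)"
  assumes conf: "(g, \<phi>, \<V>) \<in> Conf U V G J" and x: "x \<in> U" and tame: "tame (J (\<phi> x))"
  shows "einstein_eq G J (g, \<phi>, \<V>) x \<longleftrightarrow> (\<forall>a b. einstein g x a b =
      pd \<phi> a x \<bullet> (G (\<phi> x) *v pd \<phi> b x)
      - (1/2) * g x $ a $ b * (\<Sum>c\<in>UNIV. \<Sum>d\<in>UNIV. matrix_inv (g x) $ c $ d * (pd \<phi> c x \<bullet> (G (\<phi> x) *v pd \<phi> d x)))
      + (\<Sum>c\<in>UNIV. \<Sum>d\<in>UNIV. matrix_inv (g x) $ c $ d * omega (\<V> x $ a $ c) (J (\<phi> x) *v \<V> x $ b $ d)))"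
proof -
  have lor: "is_lorentzian (g x)" and skew: "\<And>a b. \<V> x $ a $ b = - \<V> x $ b $ a"
    and hodge: "hodge (g x) (\<V> x) = (\<chi> a b. - (J (\<phi> x) *v \<V> x $ a $ b))"
    using conf x unfolding Conf_iff Lor_def by blast+
  have kin: "(\<Sum>i\<in>UNIV. \<Sum>j\<in>UNIV. G (\<phi> x) $ i $ j * pd \<phi> a x $ i * pd \<phi> b x $ j) = pd \<phi> a x \<bullet> (G (\<phi> x) *v pd \<phi> b x)" for a b
    by (simp only: sum_inner_matrix mult.assoc)
  have kin2: "(\<Sum>i\<in>UNIV. \<Sum>j\<in>UNIV. \<Sum>c\<in>UNIV. \<Sum>d\<in>UNIV. G (\<phi> x) $ i $ j * matrix_inv (g x) $ c $ d * pd \<phi> c x $ i * pd \<phi> d x $ j)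
     = (\<Sum>c\<in>UNIV. \<Sum>d\<in>UNIV. matrix_inv (g x) $ c $ d * (pd \<phi> c x \<bullet> (G (\<phi> x) *v pd \<phi> d x)))"
    unfolding sum_inner_matrix sum_distrib_left by (rule trans[OF sum_swap22]) (simp only: mult_ac)
  show ?thesis
    unfolding einstein_eq_def Let_def prod.case kin kin2 Ffld_slot stress_omega[OF lor refl tame skew hodge]
    by (simp add: algebra_simps)
qed

lemma scalar_eq_defect:
  fixes J :: "real^'s::finite \<Rightarrow> real^('v::finite + 'v)^('v + 'v)"
  assumes conf: "(g, \<phi>, \<V>) \<in> Conf U V G J" and x: "x \<in> U" and V: "open V"
    and tame: "\<forall>q\<in>V. tame (J q)" and J: "J differentiable at (\<phi> x)" and G: "G differentiable at (\<phi> x)"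
  shows "scalar_eq G J (g, \<phi>, \<V>) x \<longleftrightarrow> scalar_defect G J (g, \<phi>, \<V>) x = 0"
proof -
  have lor: "is_lorentzian (g x)" and skew: "\<And>a b. \<V> x $ a $ b = - \<V> x $ b $ a"
    and hodge: "hodge (g x) (\<V> x) = (\<chi> a b. - (J (\<phi> x) *v \<V> x $ a $ b))" and \<phi>: "\<phi> x \<in> V"
    using conf x unfolding Conf_iff Lor_def by blast+
  note dt = pd_tame[OF V \<phi> tame J]
  have W: "(\<Sum>b\<in>UNIV. \<Sum>i\<in>UNIV. matrix_inv (g y) $ a $ b * G (\<phi> y) $ i $ k * pd \<phi> b y $ i) = flux g G \<phi> y a $ k" for y a k
    by (simp add: flux_def matrix_vector_mult_def transpose_def sum_distrib_left mult_ac)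
  have pdG: "pd (\<lambda>q. G q $ i $ j) k (\<phi> x) = pd G k (\<phi> x) $ i $ j" for i j k
    by (simp add: pd_nth differentiable_nth G)
  have pdR: "pd (\<lambda>q. R_of (J q) $ i $ j) k (\<phi> x) = pd (\<lambda>q. R_of (J q)) k (\<phi> x) $ i $ j" for i j k
    by (simp add: pd_nth differentiable_nth dt)
  have pdI: "pd (\<lambda>q. I_of (J q) $ i $ j) k (\<phi> x) = pd (\<lambda>q. I_of (J q)) k (\<phi> x) $ i $ j" for i j k
    by (simp add: pd_nth differentiable_nth dt)
  have kin: "(\<Sum>i\<in>UNIV. \<Sum>j\<in>UNIV. \<Sum>c\<in>UNIV. \<Sum>d\<in>UNIV. pd G k (\<phi> x) $ i $ j * pd \<phi> c x $ i * matrix_inv (g x) $ c $ d * pd \<phi> d x $ j)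
     = (\<Sum>c\<in>UNIV. \<Sum>d\<in>UNIV. matrix_inv (g x) $ c $ d * (pd \<phi> c x \<bullet> (pd G k (\<phi> x) *v pd \<phi> d x)))" for k
    unfolding sum_inner_matrix sum_distrib_left by (rule trans[OF sum_swap22]) (simp only: mult_ac)
  note src = source_omega[OF lor refl bspec[OF tame \<phi>] skew hodge dt(3-6)]
  show ?thesis
    unfolding scalar_eq_def scalar_defect_def Let_def prod.case W pdG pdR pdI kin Ffld_slot src vec_eq_iff
    by (simp only: vec_lambda_beta zero_index diff_diff_eq right_minus_eq add.assoc)
qed

lemma maxwell_eq_vector:
  assumes "\<V> differentiable at x"
  shows "maxwell_eq (g, \<phi>, \<V>) x \<longleftrightarrow>
    (\<forall>a b e. pd \<V> a x $ b $ e + pd \<V> b x $ e $ a + pd \<V> e x $ a $ b = 0)"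
  unfolding maxwell_eq_def by (auto simp: pd_nth differentiable_nth assms vec_eq_iff)

subsection \<open>Transport by a target diffeomorphism and a symplectic matrix\<close>

lemma bounded_linear_transpose: "bounded_linear (transpose :: real^'n^'m \<Rightarrow> real^'m^'n)"
  unfolding linear_conv_bounded_linear[symmetric] by (auto intro!: linearI simp: vec_eq_iff transpose_def)

lemma inner_vector_matrix: "u \<bullet> (w v* M) = (M *v u) \<bullet> w" for M :: "real^'n^'m"
  by (metis dot_lmul_matrix inner_commute)

lemma Sp_matrix_inv: "matrix_inv A \<in> Sp" if "A \<in> Sp"
proof -
  have A: "invertible A" and om: "omega (A *v \<xi>) (A *v \<eta>) = omega \<xi> \<eta>" for \<xi> \<eta>
    using that by (auto simp: Sp_def)
  have "invertible (matrix_inv A)"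
    unfolding invertible_def using matrix_inv[OF A] by blast
  moreover have "omega (matrix_inv A *v \<xi>) (matrix_inv A *v \<eta>) = omega \<xi> \<eta>" for \<xi> \<eta>
    using om[of "matrix_inv A *v \<xi>" "matrix_inv A *v \<eta>"] by (simp add: matrix_vector_mul_assoc matrix_inv[OF A])
  ultimately show ?thesis by (simp add: Sp_def)
qed

lemma hodge_matrix_vector_mult:
  "hodge m (\<chi> a b. A *v w $ a $ b) = (\<chi> a b. A *v hodge m w $ a $ b)" for w :: "real^'n::finite^4^4" and A :: "real^'n^'k::finite"
proof -
  have "linear ((*v) A)" by simp
  then show ?thesis
    by (simp add: vec_eq_iff[of "hodge _ _"] hodge_def linear_sum linear_scale)
qed

section \<open>The pushed metric and the twisted taming map\<close>

locale duality =
  fixes U :: "(real^4) set" and V :: "(real^'s::finite) set"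
    and G :: "real^'s \<Rightarrow> real^'s^'s"
    and J :: "real^'s \<Rightarrow> real^('v::finite + 'v)^('v + 'v)"
    and f :: "real^'s \<Rightarrow> real^'s" and A :: "real^('v + 'v)^('v + 'v)"
  assumes U: "open U" and V: "open V"
    and G: "riemannian_metric V G"
    and J: "taming_map V J"
    and f: "f \<in> Diff V" and A: "A \<in> Sp"
begin

abbreviation "B \<equiv> matrix_inv A"
abbreviation "h \<equiv> inv_into V f"
abbreviation "H \<equiv> push V f G"
abbreviation "K \<equiv> Jtwist V f A J"

definition "D q = matrix (frechet_derivative f (at q))"

lemma bij: "bij_betw f V V" and smooth_f: "smooth_on V f" and smooth_h: "smooth_on V h"
  using f by (auto simp: Diff_def)

lemma f_in: "p \<in> V \<Longrightarrow> f p \<in> V" and h_in: "p \<in> V \<Longrightarrow> h p \<in> V"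
  and h_f: "p \<in> V \<Longrightarrow> h (f p) = p" and f_h: "p \<in> V \<Longrightarrow> f (h p) = p"
  using bij by (auto simp: bij_betw_def inv_into_into f_inv_into_f)

lemma BA: "B ** A = mat 1" and AB: "A ** B = mat 1"
  using A by (auto simp: Sp_def matrix_inv)

lemma invertible_D: "p \<in> V \<Longrightarrow> invertible (D p)"
  using f by (force simp: Diff_def D_def invertible_det_nz)

lemma f_differentiable: "p \<in> V \<Longrightarrow> f differentiable at p"
  by (rule smooth_on_differentiable_at[OF V smooth_f])

lemma D_nth: "D p $ i $ k = frechet_derivative f (at p) (axis k 1) $ i"
  by (simp add: D_def matrix_def)

lemma pd_f: "pd f k p $ i = D p $ i $ k"
  by (simp add: D_nth pd_def)

lemma D_differentiable: "p \<in> V \<Longrightarrow> D differentiable at p"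
  by (intro differentiable_vec) (unfold D_nth, rule differentiable_nth,
      rule smooth_on_differentiable_at[OF V smooth_on_frechet_derivative[OF smooth_f]])

lemma pd_D_commute:
  assumes p: "p \<in> V"
  shows "pd D l p $ i $ k = pd D k p $ i $ l"
proof -
  let ?fi = "\<lambda>q. f q $ i"
  have sm: "smooth_on V ?fi"
    by (rule smooth_on_bounded_linear[OF V bounded_linear_vec_nth smooth_f])
  have "D q $ i $ k = frechet_derivative ?fi (at q) (axis k 1)" if "q \<in> V" for q k
    using pd_nth[OF f_differentiable[OF that], of i k] by (simp add: pd_f) (simp add: pd_def)
  then have "pd (\<lambda>q. D q $ i $ k) l p = pd (\<lambda>q. frechet_derivative ?fi (at q) (axis k 1)) l p" for k l
    by (intro pd_cong_open[OF V p])
  moreover have "pd (\<lambda>q. D q $ i $ k) l p = pd D l p $ i $ k" for k l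
    by (simp add: pd_nth differentiable_nth D_differentiable p)
  ultimately show ?thesis
    using frechet_derivative_commute[OF V sm p, of "axis k 1" "axis l 1"] by (simp add: pd_def)
qed

lemma pd_compose_f:
  fixes \<psi> :: "real^'s \<Rightarrow> 'b::real_normed_vector"
  shows "p \<in> V \<Longrightarrow> \<psi> differentiable at (f p) \<Longrightarrow> pd (\<lambda>q. \<psi> (f q)) l p = (\<Sum>k\<in>UNIV. D p $ k $ l *\<^sub>R pd \<psi> k (f p))"
  by (simp add: pd_compose f_differentiable pd_f)

text \<open>The definition of \<open>push\<close> is solved for the original metric, so that
  \<open>pd_G\<close> differentiates the Jacobian and never its inverse.\<close>

lemma G_push: "p \<in> V \<Longrightarrow> G p = transpose (D p) ** H (f p) ** D p"
proof -
  assume p: "p \<in> V"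
  let ?T = "matrix_inv (D p)"
  have "H (f p) = transpose ?T ** G p ** ?T"
    by (simp add: push_def Let_def h_f p D_def)
  then have "transpose (D p) ** H (f p) ** D p = transpose (?T ** D p) ** G p ** (?T ** D p)"
    by (simp add: matrix_transpose_mul matrix_mul_assoc)
  then show ?thesis by (simp add: matrix_inv invertible_D p transpose_mat)
qed

lemma push_symmetric: "y \<in> V \<Longrightarrow> transpose (H y) = H y"
proof -
  assume "y \<in> V"
  then have "transpose (G (h y)) = G (h y)" using G h_in by (auto simp: riemannian_metric_def)
  then show ?thesis
    by (simp add: push_def Let_def matrix_transpose_mul matrix_mul_assoc)
qed

lemma h_differentiable: "y \<in> V \<Longrightarrow> h differentiable at y"
  by (rule smooth_on_differentiable_at[OF V smooth_h])

lemma G_differentiable: "p \<in> V \<Longrightarrow> G differentiable at p"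
  using G unfolding riemannian_metric_def by (auto intro: smooth_on_differentiable_at[OF V])

lemma J_differentiable: "p \<in> V \<Longrightarrow> J differentiable at p"
  using J unfolding taming_map_def by (auto intro: smooth_on_differentiable_at[OF V])

lemma compose_h_differentiable: "y \<in> V \<Longrightarrow> \<psi> differentiable at (h y) \<Longrightarrow> (\<lambda>y. \<psi> (h y)) differentiable at y"
  using differentiable_chain_at[of h y \<psi>] h_differentiable by (simp add: o_def)

text \<open>The field equations contain only first derivatives of the target metric. For the inverse
  Jacobian inside it they come from Cramer's rule.\<close>

lemma push_differentiable: "y \<in> V \<Longrightarrow> H differentiable at y"
proof -
  assume y: "y \<in> V"
  let ?T = "\<lambda>y. matrix_inv (D (h y))"
  have "(\<lambda>y. D (h y)) differentiable at y"
    by (intro compose_h_differentiable y D_differentiable h_in)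
  then have "(\<lambda>y. D (h y) $ i $ j) differentiable at y" for i j
    by (rule differentiable_nth[OF differentiable_nth])
  moreover have "det (D (h y)) \<noteq> 0"
    using invertible_D[OF h_in[OF y]] by (simp add: invertible_det_nz)
  ultimately have "(\<lambda>y. ?T y $ i $ j) differentiable at y" for i j
    by (rule differentiable_matrix_inv)
  then have T: "?T differentiable at y"
    by (rule differentiable_vec[OF differentiable_vec])
  have "H = (\<lambda>y. transpose (?T y) ** G (h y) ** ?T y)"
    by (simp add: fun_eq_iff push_def Let_def D_def)
  then show ?thesis
    using y by (simp only:) (intro differentiable_matrix_mult T differentiable_bounded_linear[OF bounded_linear_transpose T]
        compose_h_differentiable G_differentiable h_in)
qed

lemma Jtwist_differentiable: "y \<in> V \<Longrightarrow> K differentiable at y"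
proof -
  assume y: "y \<in> V"
  have "K = (\<lambda>y. A ** J (h y) ** B)"
    by (simp add: fun_eq_iff Jtwist_def)
  then show ?thesis
    using y by (simp only:) (intro differentiable_matrix_mult differentiable_const
        compose_h_differentiable J_differentiable h_in)
qed

lemma Jtwist_f: "p \<in> V \<Longrightarrow> K (f p) = A ** J p ** B"
  by (simp add: Jtwist_def h_f)

lemma tame_J: "\<forall>p\<in>V. tame (J p)"
  using J by (auto simp: taming_map_def tame_def)

lemma omega_A: "omega (A *v \<xi>) (A *v \<eta>) = omega \<xi> \<eta>"
  using A by (auto simp: Sp_def)

lemma omega_A_left: "omega (A *v \<xi>) \<eta> = omega \<xi> (B *v \<eta>)"
  using omega_A[of \<xi> "B *v \<eta>"] by (simp add: matrix_vector_mul_assoc AB)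

text \<open>Conjugation by a symplectic matrix respects all three conditions; positivity is checked
  at \<open>B *v \<xi>\<close>, which is nonzero because \<open>A\<close> maps it back to
  \<open>\<xi>\<close>.\<close>

lemma tame_Jtwist: "\<forall>y\<in>V. tame (K y)"
proof
  fix y assume "y \<in> V"
  then have t: "tame (J (h y))" using tame_J h_in by blast
  let ?j = "J (h y)"
  have K: "K y *v \<xi> = A *v (?j *v (B *v \<xi>))" for \<xi>
    by (simp add: Jtwist_def matrix_vector_mul_assoc matrix_mul_assoc)
  have "K y *v (K y *v \<xi>) = - \<xi>" for \<xi>
  proof -
    have "K y *v (K y *v \<xi>) = A *v (?j *v ((B ** A) *v (?j *v (B *v \<xi>))))"
      by (simp only: K matrix_vector_mul_assoc[symmetric])
    also have "\<dots> = - ((A ** B) *v \<xi>)"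
      by (simp only: BA matrix_vector_mul_lid tame_square[OF t] matrix_vector_mult_minus_right)
        (simp add: matrix_vector_mul_assoc)
    finally show ?thesis by (simp add: AB)
  qed
  then have "K y ** K y = - mat 1"
    by (simp add: matrix_eq matrix_vector_mul_assoc[symmetric] matrix_vector_mult_minus_left)
  moreover have "omega (B *v \<xi>) (B *v \<eta>) = omega \<xi> \<eta>" for \<xi> \<eta>
    using Sp_matrix_inv[OF A] by (auto simp: Sp_def)
  moreover have "omega \<xi> (K y *v \<xi>) > 0" if "\<xi> \<noteq> 0" for \<xi>
  proof -
    have "A *v (B *v \<xi>) = \<xi>" by (simp add: matrix_vector_mul_assoc AB)
    with that have "B *v \<xi> \<noteq> 0" by auto
    then have "0 < omega (B *v \<xi>) (?j *v (B *v \<xi>))" using t by (simp add: tame_def)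
    also have "\<dots> = omega (A *v (B *v \<xi>)) (A *v (?j *v (B *v \<xi>)))" by (simp only: omega_A)
    also have "\<dots> = omega \<xi> (K y *v \<xi>)" by (simp only: K \<open>A *v (B *v \<xi>) = \<xi>\<close>)
    finally show ?thesis .
  qed
  ultimately show "tame (K y)" using t by (simp add: tame_def K omega_A)
qed

lemma J_Jtwist: "q \<in> V \<Longrightarrow> J q = B ** K (f q) ** A"
proof -
  assume "q \<in> V"
  then have "B ** K (f q) ** A = (B ** A) ** J q ** (B ** A)"
    by (simp add: Jtwist_f matrix_mul_assoc)
  then show ?thesis by (simp add: BA)
qed

text \<open>The constant matrix \<open>A\<close> contributes no derivative, so only the chain rule
  through \<open>f\<close> remains.\<close>

lemma pd_J:
  assumes p: "p \<in> V"
  shows "pd J l p = (\<Sum>k\<in>UNIV. D p $ k $ l *\<^sub>R (B ** pd K k (f p) ** A))"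
proof -
  note dK = Jtwist_differentiable[OF f_in[OF p]]
  have "pd J l p = pd (\<lambda>q. B ** K (f q) ** A) l p"
    by (rule pd_cong_open[OF V p J_Jtwist])
  also have "\<dots> = (\<Sum>k\<in>UNIV. D p $ k $ l *\<^sub>R pd (\<lambda>y. B ** K y ** A) k (f p))"
    by (rule pd_compose_f[OF p]) (intro differentiable_matrix_mult differentiable_const dK)
  also have "\<dots> = (\<Sum>k\<in>UNIV. D p $ k $ l *\<^sub>R (B ** pd K k (f p) ** A))"
    by (simp add: pd_matrix_mult differentiable_matrix_mult dK pd_const bounded_bilinear.zero_left[OF bounded_bilinear_matrix_mult]
        bounded_bilinear.zero_right[OF bounded_bilinear_matrix_mult])
  finally show ?thesis .
qed

text \<open>The first two terms carry second derivatives of \<open>f\<close> and are the obstruction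
  to covariance of the kinetic source; the sum over \<open>k\<close> is the covariant part.\<close>

lemma pd_G:
  assumes p: "p \<in> V"
  shows "u \<bullet> (pd G l p *v v) = (pd D l p *v u) \<bullet> (H (f p) *v (D p *v v)) + (D p *v u) \<bullet> (H (f p) *v (pd D l p *v v))
    + (\<Sum>k\<in>UNIV. D p $ k $ l * ((D p *v u) \<bullet> (pd H k (f p) *v (D p *v v))))"
proof -
  note dH = push_differentiable[OF f_in[OF p]]
  note dD = D_differentiable[OF p]
  have dHf: "(\<lambda>q. H (f q)) differentiable at p"
    using differentiable_chain_at[OF f_differentiable[OF p] dH] by (simp add: o_def)
  note dDt = differentiable_bounded_linear[OF bounded_linear_transpose dD]
  have "pd G l p = pd (\<lambda>q. transpose (D q) ** H (f q) ** D q) l p"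
    by (rule pd_cong_open[OF V p G_push])
  also have "\<dots> = transpose (D p) ** H (f p) ** pd D l p
     + (transpose (D p) ** pd (\<lambda>q. H (f q)) l p + transpose (pd D l p) ** H (f p)) ** D p"
    by (simp add: pd_matrix_mult differentiable_matrix_mult dDt dHf dD pd_bounded_linear[OF bounded_linear_transpose dD])
  finally have "u \<bullet> (pd G l p *v v) = (D p *v u) \<bullet> (H (f p) *v (pd D l p *v v))
     + ((D p *v u) \<bullet> (pd (\<lambda>q. H (f q)) l p *v (D p *v v)) + (pd D l p *v u) \<bullet> (H (f p) *v (D p *v v)))"
    by (simp add: matrix_vector_mult_add_rdistrib matrix_vector_mul_assoc[symmetric]
        inner_vector_matrix inner_add_right)
  also have "pd (\<lambda>q. H (f q)) l p *v (D p *v v) = (\<Sum>k\<in>UNIV. D p $ k $ l *\<^sub>R (pd H k (f p) *v (D p *v v)))"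
    by (simp add: pd_compose_f[OF p dH] bounded_bilinear.sum_left[OF bounded_bilinear_matrix_vector_mult]
        bounded_bilinear.scaleR_left[OF bounded_bilinear_matrix_vector_mult])
  finally show ?thesis by (simp add: inner_sum_right)
qed

end

section \<open>The map on configurations\<close>

lemma bounded_linear_twoform_map:
  "bounded_linear (\<lambda>w :: real^'n::finite^4^4. (\<chi> a b. A *v w $ a $ b) :: real^'k::finite^4^4)"
  unfolding linear_conv_bounded_linear[symmetric]
  by (rule linearI) (auto simp: vec_eq_iff[where 'b = 4] matrix_vector_right_distrib matrix_vector_mult_scaleR)

lemma smooth_on_if_restrict: "open S \<Longrightarrow> smooth_on S (\<lambda>x. if x \<in> S then f x else c) \<longleftrightarrow> smooth_on S f"
  using smooth_on_cong[of S f "\<lambda>x. if x \<in> S then f x else c"] smooth_on_cong[of S "\<lambda>x. if x \<in> S then f x else c" f] by auto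

text \<open>Stated for any \<open>K\<close> and \<open>J\<close> intertwined by \<open>f\<close> and
  \<open>A\<close>, so that it serves for the inverse pair as well, without computing a double
  twist.\<close>

lemma Amap_Conf:
  fixes A :: "real^('v::finite + 'v)^('v + 'v)" and f :: "real^'s::finite \<Rightarrow> real^'s"
  assumes U: "open U" and V: "open V" and f: "smooth_on V f" "f ` V \<subseteq> V"
    and K: "\<And>p \<xi>. p \<in> V \<Longrightarrow> K (f p) *v (A *v \<xi>) = A *v (J p *v \<xi>)"
    and c: "c \<in> Conf U V G J"
  shows "Amap U f A c \<in> Conf U V H K"
proof -
  obtain g \<phi> \<V> where ceq: "c = (g, \<phi>, \<V>)" by (cases c)
  have conf: "g \<in> Lor U" "smooth_on U \<phi>" "\<phi> ` U \<subseteq> V" "smooth_on U \<V>"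
    "\<And>x a b. x \<in> U \<Longrightarrow> \<V> x $ a $ b = - \<V> x $ b $ a"
    "\<And>x. x \<in> U \<Longrightarrow> hodge (g x) (\<V> x) = (\<chi> a b. - (J (\<phi> x) *v (\<V> x $ a $ b)))"
    using c unfolding ceq Conf_iff by blast+
  have \<phi>: "smooth_on U (\<lambda>x. f (\<phi> x))"
    by (rule smooth_on_compose[OF U V conf(3,2) f(1)])
  have \<V>: "smooth_on U (\<lambda>x. (\<chi> a b. A *v \<V> x $ a $ b))"
    by (rule smooth_on_bounded_linear[OF U bounded_linear_twoform_map conf(4)])
  have skew: "A *v \<V> x $ a $ b = - (A *v \<V> x $ b $ a)" if "x \<in> U" for x a b
    by (subst conf(5)[OF that]) (simp add: matrix_vector_mult_minus_right)
  have hodge: "hodge (g x) (\<chi> a b. A *v \<V> x $ a $ b) = (\<chi> a b. - (K (f (\<phi> x)) *v (A *v \<V> x $ a $ b)))" if "x \<in> U" for x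
  proof -
    have "\<phi> x \<in> V" using that conf(3) by blast
    then show ?thesis
      by (simp add: hodge_matrix_vector_mult conf(6)[OF that] K matrix_vector_mult_minus_right)
  qed
  show ?thesis
    unfolding ceq Amap_def prod.case Conf_iff smooth_on_if_restrict[OF U]
  proof (intro conjI ballI allI)
    fix x a b assume x: "x \<in> U"
    show "(if x \<in> U then \<chi> a b. A *v \<V> x $ a $ b else undefined) $ a $ b =
        - (if x \<in> U then \<chi> a b. A *v \<V> x $ a $ b else undefined) $ b $ a"
      using skew[OF x, of a b] by (simp only: x if_True vec_lambda_beta)
  qed (use conf(1,3) f(2) \<phi> \<V> hodge in \<open>auto simp: extensional_def\<close>)
qed

text \<open>Inside \<open>U\<close> the two maps undo each other; outside, equality holds because
  the fields are extensional and both sides are \<open>undefined\<close>.\<close>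

lemma Amap_inverse:
  fixes A B :: "real^('v::finite + 'v)^('v + 'v)"
  assumes "c \<in> Conf U V G J" and "\<And>p. p \<in> V \<Longrightarrow> h (f p) = p" and "B ** A = mat 1"
  shows "Amap U h B (Amap U f A c) = c"
proof -
  obtain g \<phi> \<V> where ceq: "c = (g, \<phi>, \<V>)" by (cases c)
  have "\<phi> \<in> extensional U" "\<phi> ` U \<subseteq> V" "\<V> \<in> extensional U"
    using assms(1) unfolding ceq Conf_iff by blast+
  then show ?thesis
    using assms(2)
    by (auto simp: ceq Amap_def fun_eq_iff extensional_def image_subset_iff matrix_vector_mul_assoc assms(3))
qed

context duality
begin

lemma Amap_Conf_twist: "c \<in> Conf U V G J \<Longrightarrow> Amap U f A c \<in> Conf U V H K"
proof (rule Amap_Conf[OF U V smooth_f])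
  show "K (f p) *v (A *v \<xi>) = A *v (J p *v \<xi>)" if "p \<in> V" for p \<xi>
    by (simp add: Jtwist_f that matrix_vector_mul_assoc matrix_mul_assoc[symmetric] BA)
qed (use f_in in auto)

lemma Amap_inverse_Conf_twist: "c \<in> Conf U V H K \<Longrightarrow> Amap U h B c \<in> Conf U V G J"
proof (rule Amap_Conf[OF U V smooth_h])
  show "J (h p) *v (B *v \<xi>) = B *v (K p *v \<xi>)" for p \<xi>
    by (simp add: Jtwist_def matrix_vector_mul_assoc matrix_mul_assoc BA)
qed (use h_in in auto)

lemma bij_betw_Conf: "bij_betw (Amap U f A) (Conf U V G J) (Conf U V H K)"
proof (rule bij_betw_byWitness[where f' = "Amap U h B"])
  show "\<forall>c\<in>Conf U V G J. Amap U h B (Amap U f A c) = c"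
    by (auto intro!: Amap_inverse simp: h_f BA)
  show "\<forall>c\<in>Conf U V H K. Amap U f A (Amap U h B c) = c"
    by (auto intro!: Amap_inverse simp: f_h AB)
qed (use Amap_Conf_twist Amap_inverse_Conf_twist in auto)

section \<open>Transport of each field equation at a point\<close>

context
  fixes g \<phi> \<V> \<phi>' \<V>' x
  assumes conf: "(g, \<phi>, \<V>) \<in> Conf U V G J" and x: "x \<in> U"
    and map: "Amap U f A (g, \<phi>, \<V>) = (g, \<phi>', \<V>')"
begin

lemma conf': "(g, \<phi>', \<V>') \<in> Conf U V H K"
  using Amap_Conf_twist[OF conf] by (simp add: map)

lemma \<phi>'_eq: "y \<in> U \<Longrightarrow> \<phi>' y = f (\<phi> y)" and \<V>'_eq: "y \<in> U \<Longrightarrow> \<V>' y = (\<chi> a b. A *v \<V> y $ a $ b)"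
  using map by (auto simp: Amap_def)

lemma \<phi>_in: "y \<in> U \<Longrightarrow> \<phi> y \<in> V"
  using conf unfolding Conf_iff by blast

lemma \<phi>_differentiable: "y \<in> U \<Longrightarrow> \<phi> differentiable at y"
  and \<phi>'_differentiable: "y \<in> U \<Longrightarrow> \<phi>' differentiable at y"
  and \<V>_differentiable: "y \<in> U \<Longrightarrow> \<V> differentiable at y"
  and \<V>'_differentiable: "y \<in> U \<Longrightarrow> \<V>' differentiable at y"
  using conf conf' smooth_on_differentiable_at[OF U] unfolding Conf_iff by blast+

lemma pd_\<phi>': "y \<in> U \<Longrightarrow> pd \<phi>' a y = D (\<phi> y) *v pd \<phi> a y"
proof -
  assume y: "y \<in> U"
  have "pd \<phi>' a y = pd (\<lambda>y. f (\<phi> y)) a y"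
    by (rule pd_cong_open[OF U y \<phi>'_eq])
  also have "\<dots> = (\<Sum>m\<in>UNIV. pd \<phi> a y $ m *\<^sub>R pd f m (\<phi> y))"
    by (rule pd_compose[OF f_differentiable[OF \<phi>_in[OF y]] \<phi>_differentiable[OF y]])
  finally show ?thesis
    by (simp add: vec_eq_iff pd_f matrix_vector_mult_def mult.commute)
qed

lemma pd_\<V>': "pd \<V>' a x = (\<chi> b e. A *v pd \<V> a x $ b $ e)"
proof -
  have "pd \<V>' a x = pd (\<lambda>y. \<chi> b e. A *v \<V> y $ b $ e) a x"
    by (rule pd_cong_open[OF U x \<V>'_eq])
  also have "\<dots> = (\<chi> b e. A *v pd \<V> a x $ b $ e)"
    by (rule pd_bounded_linear[OF bounded_linear_twoform_map \<V>_differentiable[OF x]])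
  finally show ?thesis .
qed

lemma maxwell_iff: "maxwell_eq (g, \<phi>, \<V>) x \<longleftrightarrow> maxwell_eq (g, \<phi>', \<V>') x"
proof -
  have inj: "A *v u = 0 \<longleftrightarrow> u = 0" for u
  proof
    assume "A *v u = 0"
    then have "(B ** A) *v u = 0" by (simp flip: matrix_vector_mul_assoc)
    then show "u = 0" by (simp add: BA)
  qed simp
  show ?thesis
    unfolding maxwell_eq_vector[OF \<V>_differentiable[OF x]] maxwell_eq_vector[OF \<V>'_differentiable[OF x]] pd_\<V>'
    by (simp add: matrix_vector_right_distrib[symmetric] inj)
qed

lemma omega_Jtwist: "omega (\<V>' x $ a $ b) (K (\<phi>' x) *v \<V>' x $ c $ d) = omega (\<V> x $ a $ b) (J (\<phi> x) *v \<V> x $ c $ d)"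
  by (simp add: \<V>'_eq \<phi>'_eq x omega_A_left Jtwist_f \<phi>_in matrix_vector_mul_assoc)
    (simp add: matrix_mul_assoc BA, simp add: matrix_mul_assoc[symmetric] BA)

lemma inner_push: "y \<in> U \<Longrightarrow> pd \<phi>' a y \<bullet> (H (\<phi>' y) *v pd \<phi>' b y) = pd \<phi> a y \<bullet> (G (\<phi> y) *v pd \<phi> b y)"
  by (simp add: G_push[OF \<phi>_in] pd_\<phi>' \<phi>'_eq matrix_vector_mul_assoc[symmetric] inner_vector_matrix)

lemma einstein_iff: "einstein_eq G J (g, \<phi>, \<V>) x \<longleftrightarrow> einstein_eq H K (g, \<phi>', \<V>') x"
proof -
  have "tame (J (\<phi> x))" "tame (K (\<phi>' x))"
    using tame_J tame_Jtwist \<phi>_in[OF x] f_in by (auto simp: \<phi>'_eq x)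
  from einstein_eq_omega[OF conf x this(1)] einstein_eq_omega[OF conf' x this(2)]
  show ?thesis by (simp only: inner_push[OF x] omega_Jtwist)
qed

lemma flux_push: "y \<in> U \<Longrightarrow> flux g G \<phi> y a = transpose (D (\<phi> y)) *v flux g H \<phi>' y a"
proof -
  assume y: "y \<in> U"
  have "transpose (G (\<phi> y)) *v pd \<phi> b y = transpose (D (\<phi> y)) *v (transpose (H (\<phi>' y)) *v pd \<phi>' b y)" for b
    by (simp only: G_push[OF \<phi>_in[OF y]] pd_\<phi>'[OF y] \<phi>'_eq[OF y] matrix_transpose_mul matrix_vector_mul_assoc
        matrix_mul_assoc transpose_transpose)
  moreover have "linear ((*v) (transpose (D (\<phi> y))))" by simp
  ultimately show ?thesis
    by (simp only: flux_def linear_sum linear_scale)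
qed

lemma inverse_metric_differentiable: "(\<lambda>y. matrix_inv (g y) $ a $ b) differentiable at x"
proof (rule differentiable_matrix_inv)
  have "smooth_on U g" "is_lorentzian (g x)"
    using conf x unfolding Conf_iff Lor_def by blast+
  then show "det (g x) \<noteq> 0" and "(\<lambda>y. g y $ i $ j) differentiable at x" for i j
    using is_lorentzian_det_neg smooth_on_differentiable_at[OF U _ x]
    by (force, intro differentiable_nth) blast
qed

lemma flux_differentiable: "(\<lambda>y. flux g H \<phi>' y a) differentiable at x"
proof -
  have "smooth_on U \<phi>'" using conf' unfolding Conf_iff by blast
  then have "(\<lambda>y. pd \<phi>' b y) differentiable at x" for b
    unfolding pd_def by (intro smooth_on_differentiable_at[OF U _ x] smooth_on_frechet_derivative)
  moreover have "(\<lambda>y. H (\<phi>' y)) differentiable at x"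
    using differentiable_chain_at[OF \<phi>'_differentiable[OF x] push_differentiable] f_in[OF \<phi>_in[OF x]]
    by (simp add: o_def \<phi>'_eq x)
  then have "(\<lambda>y. transpose (H (\<phi>' y))) differentiable at x"
    by (rule differentiable_bounded_linear[OF bounded_linear_transpose])
  ultimately show ?thesis
    unfolding flux_def
    by (intro differentiable_sum ballI differentiable_scaleR inverse_metric_differentiable finite
        differentiable_bounded_bilinear[OF bounded_bilinear_matrix_vector_mult])
qed

text \<open>The last summand, from differentiating the Jacobian along \<open>\<phi>\<close>, is
  brought to exactly the form in which it recurs in \<open>kinetic_push\<close>.\<close>

lemma pd_flux:
  "pd (\<lambda>y. flux g G \<phi> y a $ l) a x =
     (\<Sum>k\<in>UNIV. D (\<phi> x) $ k $ l * pd (\<lambda>y. flux g H \<phi>' y a $ k) a x)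
     + (pd D l (\<phi> x) *v pd \<phi> a x) \<bullet> flux g H \<phi>' x a"
proof -
  note p = \<phi>_in[OF x]
  have fl: "(\<lambda>y. flux g H \<phi>' y a $ k) differentiable at x" for k
    by (rule differentiable_nth[OF flux_differentiable])
  have "(\<lambda>y. D (\<phi> y)) differentiable at x"
    using differentiable_chain_at[OF \<phi>_differentiable[OF x] D_differentiable[OF p]] by (simp add: o_def)
  then have dD: "(\<lambda>y. D (\<phi> y) $ k $ l) differentiable at x" for k
    by (rule differentiable_nth[OF differentiable_nth])
  have dD': "(\<lambda>q. D q $ k $ l) differentiable at (\<phi> x)" for k
    by (rule differentiable_nth[OF differentiable_nth[OF D_differentiable[OF p]]])
  have pdD: "pd (\<lambda>y. D (\<phi> y) $ k $ l) a x = (pd D l (\<phi> x) *v pd \<phi> a x) $ k" for k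
  proof -
    have "pd (\<lambda>y. D (\<phi> y) $ k $ l) a x = (\<Sum>m\<in>UNIV. pd \<phi> a x $ m *\<^sub>R pd (\<lambda>q. D q $ k $ l) m (\<phi> x))"
      by (rule pd_compose[OF dD' \<phi>_differentiable[OF x]])
    \<comment> \<open>Symmetry of second derivatives exchanges \<open>l\<close> and
      \<open>m\<close>, so that the sum over \<open>m\<close> becomes the matrix
      \<open>pd D l\<close> applied to the velocity.\<close>
    also have "\<dots> = (\<Sum>m\<in>UNIV. pd \<phi> a x $ m * pd D l (\<phi> x) $ k $ m)"
      by (simp add: pd_nth differentiable_nth D_differentiable p pd_D_commute[OF p, of l])
    finally show ?thesis by (simp add: matrix_vector_mult_def mult.commute)
  qed
  have "pd (\<lambda>y. flux g G \<phi> y a $ l) a x = pd (\<lambda>y. \<Sum>k\<in>UNIV. D (\<phi> y) $ k $ l * flux g H \<phi>' y a $ k) a x"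
    by (rule pd_cong_open[OF U x], subst flux_push) (simp_all add: matrix_vector_mult_def transpose_def del: transpose_matrix_vector)
  also have "\<dots> = (\<Sum>k\<in>UNIV. pd (\<lambda>y. D (\<phi> y) $ k $ l * flux g H \<phi>' y a $ k) a x)"
    by (rule pd_sum) (rule differentiable_mult[OF dD fl])
  also have "\<dots> = (\<Sum>k\<in>UNIV. D (\<phi> x) $ k $ l * pd (\<lambda>y. flux g H \<phi>' y a $ k) a x)
      + (\<Sum>k\<in>UNIV. (pd D l (\<phi> x) *v pd \<phi> a x) $ k * flux g H \<phi>' x a $ k)"
    by (simp only: pd_mult[OF dD fl] pdD sum.distrib)
  finally show ?thesis by (simp add: inner_vec_def)
qed

lemma inverse_metric_symmetric: "matrix_inv (g x) $ a $ b = matrix_inv (g x) $ b $ a"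
proof -
  have "is_lorentzian (g x)" using conf x unfolding Conf_iff Lor_def by blast
  from arg_cong[OF lorentzian_inverse(3)[OF this refl], of "\<lambda>M. M $ b $ a"]
  show ?thesis by (simp add: transpose_def)
qed

text \<open>The second derivatives of \<open>f\<close> produced by the divergence of the flux and by the derivative of
  the target metric cancel.\<close>

lemma kinetic_push:
  "(1/2) * (\<Sum>c\<in>UNIV. \<Sum>d\<in>UNIV. matrix_inv (g x) $ c $ d * (pd \<phi> c x \<bullet> (pd G l (\<phi> x) *v pd \<phi> d x))) =
    (\<Sum>a\<in>UNIV. (pd D l (\<phi> x) *v pd \<phi> a x) \<bullet> flux g H \<phi>' x a)
    + (\<Sum>k\<in>UNIV. D (\<phi> x) $ k $ l * ((1/2) * (\<Sum>c\<in>UNIV. \<Sum>d\<in>UNIV.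
         matrix_inv (g x) $ c $ d * (pd \<phi>' c x \<bullet> (pd H k (\<phi>' x) *v pd \<phi>' d x)))))"
proof -
  note p = \<phi>_in[OF x]
  let ?N = "matrix_inv (g x)"
  let ?e = "\<lambda>a. pd D l (\<phi> x) *v pd \<phi> a x"
  let ?X = "\<Sum>c\<in>UNIV. \<Sum>d\<in>UNIV. ?N $ c $ d * (?e c \<bullet> (H (\<phi>' x) *v pd \<phi>' d x))"
  let ?X' = "\<Sum>c\<in>UNIV. \<Sum>d\<in>UNIV. ?N $ c $ d * (pd \<phi>' c x \<bullet> (H (\<phi>' x) *v ?e d))"
  let ?Y = "\<lambda>k. \<Sum>c\<in>UNIV. \<Sum>d\<in>UNIV. ?N $ c $ d * (pd \<phi>' c x \<bullet> (pd H k (\<phi>' x) *v pd \<phi>' d x))"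
  have sym: "transpose (H (\<phi>' x)) = H (\<phi>' x)"
    by (simp add: push_symmetric f_in p \<phi>'_eq x)
  have "(\<Sum>c\<in>UNIV. \<Sum>d\<in>UNIV. ?N $ c $ d * (pd \<phi> c x \<bullet> (pd G l (\<phi> x) *v pd \<phi> d x))) =
     ?X + ?X' + (\<Sum>c\<in>UNIV. \<Sum>d\<in>UNIV. \<Sum>k\<in>UNIV. D (\<phi> x) $ k $ l *
        (?N $ c $ d * (pd \<phi>' c x \<bullet> (pd H k (\<phi>' x) *v pd \<phi>' d x))))"
    unfolding pd_G[OF p] pd_\<phi>'[OF x, symmetric] \<phi>'_eq[OF x, symmetric] distrib_left sum.distrib
    by (simp add: sum_distrib_left mult.left_commute)
  also have "(\<Sum>c\<in>UNIV. \<Sum>d\<in>UNIV. \<Sum>k\<in>UNIV. D (\<phi> x) $ k $ l *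
        (?N $ c $ d * (pd \<phi>' c x \<bullet> (pd H k (\<phi>' x) *v pd \<phi>' d x)))) = (\<Sum>k\<in>UNIV. D (\<phi> x) $ k $ l * ?Y k)"
    unfolding sum_distrib_left by (rule trans[OF sum.cong[OF refl sum.swap] sum.swap])
  \<comment> \<open>By symmetry of the target metric and of the inverse metric the two terms with
    second derivatives coincide; their sum absorbs the prefactor 1/2.\<close>
  also have "?X' = ?X"
  proof -
    have "pd \<phi>' c x \<bullet> (H (\<phi>' x) *v ?e d) = ?e d \<bullet> (H (\<phi>' x) *v pd \<phi>' c x)" for c d
      using inner_matrix_transpose[of "pd \<phi>' c x" "H (\<phi>' x)" "?e d"] unfolding sym by (simp only: inner_commute)
    then show ?thesis by (subst sum.swap) (simp only: inverse_metric_symmetric)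
  qed
  also have "?X = (\<Sum>a\<in>UNIV. ?e a \<bullet> flux g H \<phi>' x a)"
    by (simp only: flux_def inner_sum_right inner_scaleR_right sym)
  finally show ?thesis
    by (simp add: sum_distrib_left[symmetric] algebra_simps sum_divide_distrib[symmetric])
qed

lemma source_push:
  "(\<Sum>a\<in>UNIV. \<Sum>b\<in>UNIV. \<Sum>c\<in>UNIV. \<Sum>d\<in>UNIV. matrix_inv (g x) $ a $ c * matrix_inv (g x) $ b $ d
          * omega (\<V> x $ a $ b) (pd J l (\<phi> x) *v \<V> x $ c $ d)) =
   (\<Sum>k\<in>UNIV. D (\<phi> x) $ k $ l * (\<Sum>a\<in>UNIV. \<Sum>b\<in>UNIV. \<Sum>c\<in>UNIV. \<Sum>d\<in>UNIV. matrix_inv (g x) $ a $ c * matrix_inv (g x) $ b $ d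
          * omega (\<V>' x $ a $ b) (pd K k (\<phi>' x) *v \<V>' x $ c $ d)))"
proof -
  have om: "linear (omega \<xi>)" for \<xi> :: "real^('v + 'v)"
    by (rule linearI) (simp_all add: omega_def sum.distrib sum_distrib_left algebra_simps sum_subtractf)
  have "omega (\<V> x $ a $ b) (pd J l (\<phi> x) *v \<V> x $ c $ d) =
     (\<Sum>k\<in>UNIV. D (\<phi> x) $ k $ l * omega (\<V>' x $ a $ b) (pd K k (\<phi>' x) *v \<V>' x $ c $ d))" for a b c d
    by (simp add: pd_J[OF \<phi>_in[OF x]] bounded_bilinear.sum_left[OF bounded_bilinear_matrix_vector_mult]
        bounded_bilinear.scaleR_left[OF bounded_bilinear_matrix_vector_mult] linear_sum[OF om] linear_scale[OF om]
        \<V>'_eq[OF x] \<phi>'_eq[OF x] omega_A_left matrix_vector_mul_assoc matrix_mul_assoc)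
  then show ?thesis
    unfolding sum_distrib_left by (subst sum_rotate4) (simp only: sum_distrib_left mult.left_commute)
qed

text \<open>The metric \<open>g\<close> is not moved, so its inverse and Christoffel symbols are
  common to both sides. The inhomogeneous sums of \<open>pd_flux\<close> and
  \<open>kinetic_push\<close> are identical and drop out of the difference.\<close>

lemma scalar_defect_push:
  "scalar_defect G J (g, \<phi>, \<V>) x = transpose (D (\<phi> x)) *v scalar_defect H K (g, \<phi>', \<V>') x"
proof -
  let ?D = "\<lambda>k l. D (\<phi> x) $ k $ l"
  let ?P = "\<lambda>k. \<Sum>a\<in>UNIV. pd (\<lambda>y. flux g H \<phi>' y a $ k) a x"
  let ?C = "\<lambda>k. \<Sum>a\<in>UNIV. \<Sum>b\<in>UNIV. christ g x a a b * flux g H \<phi>' x b $ k"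
  let ?Y = "\<lambda>k. (1/2) * (\<Sum>c\<in>UNIV. \<Sum>d\<in>UNIV. matrix_inv (g x) $ c $ d * (pd \<phi>' c x \<bullet> (pd H k (\<phi>' x) *v pd \<phi>' d x)))"
  let ?S = "\<lambda>k. (1/4) * (\<Sum>a\<in>UNIV. \<Sum>b\<in>UNIV. \<Sum>c\<in>UNIV. \<Sum>d\<in>UNIV. matrix_inv (g x) $ a $ c * matrix_inv (g x) $ b $ d
          * omega (\<V>' x $ a $ b) (pd K k (\<phi>' x) *v \<V>' x $ c $ d))"
  have flux: "flux g G \<phi> x b $ l = (\<Sum>k\<in>UNIV. ?D k l * flux g H \<phi>' x b $ k)" for b l
    by (subst flux_push[OF x]) (simp add: matrix_vector_mult_def transpose_def del: transpose_matrix_vector)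
  have P: "(\<Sum>a\<in>UNIV. pd (\<lambda>y. flux g G \<phi> y a $ l) a x) =
     (\<Sum>k\<in>UNIV. ?D k l * ?P k) + (\<Sum>a\<in>UNIV. (pd D l (\<phi> x) *v pd \<phi> a x) \<bullet> flux g H \<phi>' x a)" for l
    unfolding pd_flux sum.distrib sum_distrib_left by (subst sum.swap) (rule refl)
  have C: "(\<Sum>a\<in>UNIV. \<Sum>b\<in>UNIV. christ g x a a b * flux g G \<phi> x b $ l) = (\<Sum>k\<in>UNIV. ?D k l * ?C k)" for l
    unfolding flux sum_distrib_left mult.left_commute[of _ "?D _ l"]
    by (rule trans[OF sum.cong[OF refl sum.swap] sum.swap])
  have S: "(1/4) * (\<Sum>k\<in>UNIV. ?D k l * s k) = (\<Sum>k\<in>UNIV. ?D k l * ((1/4) * s k))" for l and s :: "'s \<Rightarrow> real"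
    by (simp add: sum_distrib_left)
  have "scalar_defect G J (g, \<phi>, \<V>) x $ l = (\<Sum>k\<in>UNIV. ?D k l * ?P k) + (\<Sum>k\<in>UNIV. ?D k l * ?C k)
      - (\<Sum>k\<in>UNIV. ?D k l * ?Y k) - (\<Sum>k\<in>UNIV. ?D k l * ?S k)" for l
    unfolding scalar_defect_def prod.case vec_lambda_beta P C kinetic_push source_push S by simp
  also have "\<dots> l = (\<Sum>k\<in>UNIV. ?D k l * scalar_defect H K (g, \<phi>', \<V>') x $ k)" for l
    unfolding scalar_defect_def prod.case vec_lambda_beta right_diff_distrib distrib_left sum.distrib sum_subtractf ..
  finally show ?thesis
    by (simp add: vec_eq_iff matrix_vector_mult_def transpose_def del: transpose_matrix_vector)
qed

lemma scalar_iff: "scalar_eq G J (g, \<phi>, \<V>) x \<longleftrightarrow> scalar_eq H K (g, \<phi>', \<V>') x"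
proof -
  note p = \<phi>_in[OF x]
  have p': "\<phi>' x \<in> V" by (simp add: \<phi>'_eq x f_in p)
  have "invertible (transpose (D (\<phi> x)))" by (intro transpose_invertible invertible_D p)
  then have inj: "transpose (D (\<phi> x)) *v u = 0 \<longleftrightarrow> u = 0" for u
    by (metis invertible_left_inverse matrix_left_invertible_ker matrix_vector_mult_0_right)
  show ?thesis
    unfolding scalar_eq_defect[OF conf x V tame_J J_differentiable[OF p] G_differentiable[OF p]]
      scalar_eq_defect[OF conf' x V tame_Jtwist Jtwist_differentiable[OF p'] push_differentiable[OF p']]
      scalar_defect_push inj ..
qed

end

text \<open>The equivalence, in place of one implication, lets \<open>bij_betw_Sol\<close> take a
  preimage among configurations and conclude at once that it is a solution.\<close>

lemma Sol_iff: "c \<in> Conf U V G J \<Longrightarrow> c \<in> Sol U V G J \<longleftrightarrow> Amap U f A c \<in> Sol U V H K"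
proof -
  assume c: "c \<in> Conf U V G J"
  obtain g \<phi> \<V> where ceq: "c = (g, \<phi>, \<V>)" by (cases c)
  obtain \<phi>' \<V>' where map: "Amap U f A (g, \<phi>, \<V>) = (g, \<phi>', \<V>')" by (simp add: Amap_def)
  note iffs = einstein_iff[OF c[unfolded ceq] _ map] scalar_iff[OF c[unfolded ceq] _ map] maxwell_iff[OF c[unfolded ceq] _ map]
  show ?thesis
    using c Amap_Conf_twist[OF c] iffs unfolding Sol_def ceq map by blast
qed

lemma bij_betw_Sol: "bij_betw (Amap U f A) (Sol U V G J) (Sol U V H K)"
proof -
  have "Amap U f A ` Sol U V G J = Sol U V H K"
  proof
    show "Amap U f A ` Sol U V G J \<subseteq> Sol U V H K"
      using Sol_iff by (auto simp: Sol_def[of U V G J])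
    show "Sol U V H K \<subseteq> Amap U f A ` Sol U V G J"
    proof
      fix c assume c: "c \<in> Sol U V H K"
      then have "c \<in> Amap U f A ` Conf U V G J"
        using bij_betw_Conf by (auto simp: bij_betw_def Sol_def)
      then obtain c0 where "c0 \<in> Conf U V G J" "c = Amap U f A c0" by blast
      with c Sol_iff show "c \<in> Amap U f A ` Sol U V G J" by blast
    qed
  qed
  moreover have "Sol U V G J \<subseteq> Conf U V G J" by (auto simp: Sol_def)
  ultimately show ?thesis
    using bij_betw_Conf by (auto simp: bij_betw_def intro: inj_on_subset)
qed

end

theorem theorem2p17:
  fixes U :: "(real^4) set" and V :: "(real^'s::finite) set"
    and G :: "real^'s \<Rightarrow> real^'s^'s"
    and J :: "real^'s \<Rightarrow> real^('v::finite + 'v)^('v + 'v)"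
    and f :: "real^'s \<Rightarrow> real^'s" and A :: "real^('v + 'v)^('v + 'v)"
  assumes "open U" and "U \<noteq> {}" and "contractible U" and "bounded U"
    and "open V"
    and "riemannian_metric V G"
    and "taming_map V J"
    and "f \<in> Diff V" and "A \<in> Sp"
  shows "bij_betw (Amap U f A) (Conf U V G J) (Conf U V (push V f G) (Jtwist V f A J))
       \<and> bij_betw (Amap U f A) (Sol U V G J) (Sol U V (push V f G) (Jtwist V f A J))"
proof -
  interpret duality U V G J f A
    using assms by unfold_locales
  show ?thesis
    using bij_betw_Conf bij_betw_Sol by blast
qed

end
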